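(* Let $M$ be a compact oriented $3$-manifold with triangulated boundary, triangulated (extending the boundary triangulation) so that every tetrahedron has four distinct vertices, with generic coordinates assigned to the vertices. Let $\mathcal C,\mathcal D$ be any two sets of boundary edges with $|\mathcal C|=|\mathcal D|$. Then the sequence $$0\longrightarrow (dx_{\mathrm{inner}})\xrightarrow{f_2}(dl_{\mathrm{inner}},dl_{\mathcal C})\xrightarrow{f_3}(d\omega,d\alpha_{\mathcal D})\xrightarrow{f_4}(dx^*_{\mathrm{inner}})\longrightarrow 0$$ is an algebraic complex, i.e. $f_3\circ f_2=0$ and $f_4\circ f_3=0$.
   Context: Triangulations need not be combinatorial (repeated simplices in boundaries and several simplices with the same vertices are allowed), but the four vertices of each tetrahedron are distinct. Vertices are inner or boundary; an edge is a boundary edge if it lies entirely in $\partial M$, otherwise it is inner. Each vertex $A$ gets coordinates $(x_A,y_A,z_A)\in\mathbb R^3$ in general position; edge lengths are Euclidean distances $l_{AB}$; each tetrahedron $ABCD$ is written in positively oriented vertex order and has oriented volume $V_{ABCD}=\frac16\det(\overrightarrow{AB},\overrightarrow{AC},\overrightarrow{AD})$; its dihedral angles, as functions of its six edge lengths, carry the sign of its volume. For an inner edge $i$, $\omega_i=-\sum_k\varphi_i^{(k)}\bmod 2\pi$ (sum of signed dihedral angles at $i$ over the tetrahedra around $i$); for a boundary edge $i$, $\alpha_i$ is defined by the same formula. All lengths are regarded as independent variables. Spaces are column-vector spaces: $(dx_{\mathrm{inner}})$ and $(dx^*_{\mathrm{inner}})$ are indexed by the three coordinates of each inner vertex; $(dl_{\mathrm{inner}},dl_{\mathcal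 C})$ is indexed by all inner edges together with the edges of $\mathcal C$; $(d\omega,d\alpha_{\mathcal D})$ is indexed by all inner edges together with the edges of $\mathcal D$. $f_2$ is the Jacobian of the lengths of inner edges and edges of $\mathcal C$ with respect to the coordinates of inner vertices (boundary vertices fixed); $f_3$ is the matrix of partial derivatives of $\omega_i$ (inner $i$) and $\alpha_i$ ($i\in\mathcal D$) with respect to the lengths of inner edges and edges of $\mathcal C$, evaluated at the lengths coming from the coordinates; $f_4=-(f_2^{\mathcal D})^{\mathrm T}$, where $f_2^{\mathcal D}$ is the matrix defined as $f_2$ but with $\mathcal D$ in place of $\mathcal C$. *)

theory Defs
  imports "HOL-Analysis.Analysis" "HOL-Combinatorics.Permutations"
begin

section \<open>Triangulated compact oriented 3-manifolds (possibly non-combinatorial)\<close>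

text \<open>A triangulation is a finite set of tetrahedra. Tetrahedron t has vertex positions
  0..3 (listed in positively oriented order), its vertices are tv t i, and the edge of t
  joining positions i and j is te t i j. Edges carry their two endpoints eA e, eB e.
  The face of t opposite position k is either a boundary face (glue t k = None) or glued
  to the face opposite position sigma k of tetrahedron t', glue t k = Some (t', sigma),
  where sigma is a permutation of the positions 0..3 describing the gluing.
  Vertices and edges are the equivalence classes of corners / tetrahedron edges under
  the gluings (non-combinatorial triangulations are allowed).\<close>

record ('v, 'e, 't) triang =
  tets :: "'t set"
  tv   :: "'t \<Rightarrow> nat \<Rightarrow> 'v"
  te   :: "'t \<Rightarrow> nat \<Rightarrow> nat \<Rightarrow> 'e"
  eA   :: "'e \<Rightarrow> 'v"
  eB   :: "'e \<Rightarrow> 'v"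
  glue :: "'t \<Rightarrow> nat \<Rightarrow> ('t \<times> (nat \<Rightarrow> nat)) option"

definition tri_verts :: "('v,'e,'t) triang \<Rightarrow> 'v set" where
  "tri_verts T = {tv T t i | t i. t \<in> tets T \<and> i < 4}"

definition tri_edges :: "('v,'e,'t) triang \<Rightarrow> 'e set" where
  "tri_edges T = {te T t i j | t i j. t \<in> tets T \<and> i < 4 \<and> j < 4 \<and> i \<noteq> j}"

definition bface :: "('v,'e,'t) triang \<Rightarrow> 't \<Rightarrow> nat \<Rightarrow> bool" where
  "bface T t k \<longleftrightarrow> t \<in> tets T \<and> k < 4 \<and> glue T t k = None"

text \<open>Boundary vertices / edges: those lying in the boundary, i.e. in some boundary face.\<close>
definition bdry_verts :: "('v,'e,'t) triang \<Rightarrow> 'v set" where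
  "bdry_verts T = {tv T t i | t k i. bface T t k \<and> i < 4 \<and> i \<noteq> k}"

definition bdry_edges :: "('v,'e,'t) triang \<Rightarrow> 'e set" where
  "bdry_edges T = {te T t i j | t k i j. bface T t k \<and> i < 4 \<and> j < 4 \<and> i \<noteq> j
                                       \<and> i \<noteq> k \<and> j \<noteq> k}"

definition inner_verts :: "('v,'e,'t) triang \<Rightarrow> 'v set" where
  "inner_verts T = tri_verts T - bdry_verts T"

definition inner_edges :: "('v,'e,'t) triang \<Rightarrow> 'e set" where
  "inner_edges T = tri_edges T - bdry_edges T"

text \<open>Adjacency of corners (t,i) and of oriented tetrahedron edges (t,i,j) across glued faces.\<close>
definition corner_adj :: "('v,'e,'t) triang \<Rightarrow> (('t \<times> nat) \<times> ('t \<times> nat)) set" where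
  "corner_adj T = {((t, i), (t', \<sigma> i)) | t k i t' \<sigma>.
       t \<in> tets T \<and> k < 4 \<and> i < 4 \<and> i \<noteq> k \<and> glue T t k = Some (t', \<sigma>)}"

definition edge_adj :: "('v,'e,'t) triang \<Rightarrow> (('t \<times> nat \<times> nat) \<times> ('t \<times> nat \<times> nat)) set" where
  "edge_adj T = {((t, i, j), (t', \<sigma> i, \<sigma> j)) | t k i j t' \<sigma>.
       t \<in> tets T \<and> k < 4 \<and> i < 4 \<and> j < 4 \<and> i \<noteq> j \<and> i \<noteq> k \<and> j \<noteq> k
       \<and> glue T t k = Some (t', \<sigma>)}"

text \<open>Twice the Euler characteristic of the link of a vertex v: the link has one vertex
  per edge at v, one triangle per tetrahedron at v, and (3 n + b)/2 edges, where n is the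
  number of tetrahedra at v and b the number of boundary faces at v.\<close>
definition link_twice_euler :: "('v,'e,'t) triang \<Rightarrow> 'v \<Rightarrow> int" where
  "link_twice_euler T v =
     2 * int (card {e \<in> tri_edges T. eA T e = v \<or> eB T e = v})
     - int (card {t \<in> tets T. v \<in> tv T t ` {..<4}})
     - int (card {(t, k). bface T t k \<and> v \<in> tv T t ` ({..<4} - {k})})"

definition oriented_3manifold_triangulation :: "('v,'e,'t) triang \<Rightarrow> bool" where
  "oriented_3manifold_triangulation T \<longleftrightarrow>
     finite (tets T) \<and>
     \<comment> \<open>the four vertices of each tetrahedron are distinct\<close>
     (\<forall>t \<in> tets T. inj_on (tv T t) {..<4}) \<and>
     \<comment> \<open>edges of a tetrahedron and their endpoints\<close>
     (\<forall>t \<in> tets T. \<forall>i<4. \<forall>j<4. i \<noteq> j \<longrightarrow>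
         te T t i j = te T t j i \<and>
         {eA T (te T t i j), eB T (te T t i j)} = {tv T t i, tv T t j}) \<and>
     \<comment> \<open>face gluings: an involution on non-boundary faces, compatible with vertices and
        edges, and orientation reversing (odd permutation of positions), so that the
        positive vertex orders of all tetrahedra define one orientation of M\<close>
     (\<forall>t \<in> tets T. \<forall>k<4. \<forall>t' \<sigma>. glue T t k = Some (t', \<sigma>) \<longrightarrow>
         t' \<in> tets T \<and> \<sigma> permutes {..<4} \<and> \<not> evenperm \<sigma> \<and>
         (t', \<sigma> k) \<noteq> (t, k) \<and>
         glue T t' (\<sigma> k) = Some (t, inv \<sigma>) \<and>
         (\<forall>i<4. i \<noteq> k \<longrightarrow> tv T t' (\<sigma> i) = tv T t i) \<and>
         (\<forall>i<4. \<forall>j<4. i \<noteq> j \<and> i \<noteq> k \<and> j \<noteq> k \<longrightarrow> te T t' (\<sigma> i) (\<sigma> j) = te T t i j)) \<and>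
     \<comment> \<open>vertices are the classes of corners under the gluings\<close>
     (\<forall>t \<in> tets T. \<forall>t' \<in> tets T. \<forall>i<4. \<forall>i'<4.
         tv T t i = tv T t' i' \<longrightarrow> ((t, i), (t', i')) \<in> (corner_adj T)\<^sup>*) \<and>
     \<comment> \<open>edges are the classes of tetrahedron edges under the gluings\<close>
     (\<forall>t \<in> tets T. \<forall>t' \<in> tets T. \<forall>i<4. \<forall>j<4. \<forall>i'<4. \<forall>j'<4.
         i \<noteq> j \<and> i' \<noteq> j' \<and> te T t i j = te T t' i' j' \<and> tv T t i = tv T t' i' \<longrightarrow>
         ((t, i, j), (t', i', j')) \<in> (edge_adj T)\<^sup>*) \<and>
     \<comment> \<open>manifold condition: the (connected) link of every inner vertex is a 2-sphere
        (Euler characteristic 2), of every boundary vertex a 2-disk (Euler characteristic 1)\<close>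
     (\<forall>v \<in> tri_verts T. link_twice_euler T v = (if v \<in> bdry_verts T then 2 else 4))"

section \<open>Geometry\<close>

text \<open>Coordinates in general position: any at most four distinct vertices have distinct,
  affinely independent coordinates.\<close>
definition general_position :: "('v,'e,'t) triang \<Rightarrow> ('v \<Rightarrow> real^3) \<Rightarrow> bool" where
  "general_position T x \<longleftrightarrow>
     (\<forall>S \<subseteq> tri_verts T. card S \<le> 4 \<longrightarrow> inj_on x S \<and> \<not> affine_dependent (x ` S))"

text \<open>Oriented volume V_ABCD = det(AB, AC, AD)/6 (the determinant of the matrix with rows
  AB, AC, AD equals that with these columns).\<close>
definition tet_volume :: "('v,'e,'t) triang \<Rightarrow> ('v \<Rightarrow> real^3) \<Rightarrow> 't \<Rightarrow> real" where
  "tet_volume T x t = det (vector [x (tv T t 1) - x (tv T t 0),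
                                   x (tv T t 2) - x (tv T t 0),
                                   x (tv T t 3) - x (tv T t 0)] :: real^3^3) / 6"

definition edge_length :: "('v,'e,'t) triang \<Rightarrow> ('v \<Rightarrow> real^3) \<Rightarrow> 'e \<Rightarrow> real" where
  "edge_length T x e = dist (x (eA T e)) (x (eB T e))"

text \<open>Cosine of the plane angle at position a of tetrahedron t between the edges to
  positions b and c, as a function of the edge lengths L (law of cosines).\<close>
definition cos_face_angle :: "('v,'e,'t) triang \<Rightarrow> 't \<Rightarrow> ('e \<Rightarrow> real) \<Rightarrow> nat \<Rightarrow> nat \<Rightarrow> nat \<Rightarrow> real" where
  "cos_face_angle T t L a b c =
     ((L (te T t a b))\<^sup>2 + (L (te T t a c))\<^sup>2 - (L (te T t b c))\<^sup>2)
       / (2 * L (te T t a b) * L (te T t a c))"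

text \<open>Unsigned dihedral angle of tetrahedron t at its edge joining positions a, b, as a
  function of the six edge lengths (spherical law of cosines at vertex a; c, d are the
  remaining two positions).\<close>
definition dihedral_angle :: "('v,'e,'t) triang \<Rightarrow> 't \<Rightarrow> ('e \<Rightarrow> real) \<Rightarrow> nat \<Rightarrow> nat \<Rightarrow> real" where
  "dihedral_angle T t L a b =
     (let c = Min ({..<4} - {a, b}); d = Max ({..<4} - {a, b}) in
      arccos ((cos_face_angle T t L a c d - cos_face_angle T t L a b c * cos_face_angle T t L a b d)
              / (sqrt (1 - (cos_face_angle T t L a b c)\<^sup>2) * sqrt (1 - (cos_face_angle T t L a b d)\<^sup>2))))"

text \<open>Occurrences of edge e in tetrahedra: triples (t, a, b) with a < b.\<close>
definition around :: "('v,'e,'t) triang \<Rightarrow> 'e \<Rightarrow> ('t \<times> nat \<times> nat) set" where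
  "around T e = {(t, a, b). t \<in> tets T \<and> a < b \<and> b < 4 \<and> te T t a b = e}"

text \<open>omega_i (inner i) resp. alpha_i (boundary i) as a real-valued function of the
  (independent) edge lengths L: minus the sum of the signed dihedral angles at i, the sign
  being that of the oriented volume of the tetrahedron for the given coordinates x.
  (The reduction mod 2 pi does not affect derivatives; we use this real lift.)\<close>
definition deficit :: "('v,'e,'t) triang \<Rightarrow> ('v \<Rightarrow> real^3) \<Rightarrow> 'e \<Rightarrow> ('e \<Rightarrow> real) \<Rightarrow> real" where
  "deficit T x e L =
     - (\<Sum>(t, a, b) \<in> around T e. sgn (tet_volume T x t) * dihedral_angle T t L a b)"

text \<open>Partial derivative of f at p with respect to variable j.\<close>
definition partial_at :: "(('i \<Rightarrow> real) \<Rightarrow> real) \<Rightarrow> ('i \<Rightarrow> real) \<Rightarrow> 'i \<Rightarrow> real" where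
  "partial_at f p j = deriv (\<lambda>s. f (p(j := s))) (p j)"

text \<open>Coordinate variables are pairs (vertex, coordinate index).\<close>
definition point_of :: "('v \<times> 3 \<Rightarrow> real) \<Rightarrow> 'v \<Rightarrow> real^3" where
  "point_of c v = (\<chi> k. c (v, k))"

definition coords_of :: "('v \<Rightarrow> real^3) \<Rightarrow> ('v \<times> 3 \<Rightarrow> real)" where
  "coords_of x = (\<lambda>(v, k). x v $ k)"

text \<open>Jacobian entry d l_j / d x_(v,k) (used both for f_2 and for f_2^D).\<close>
definition f2_entry :: "('v,'e,'t) triang \<Rightarrow> ('v \<Rightarrow> real^3) \<Rightarrow> 'e \<Rightarrow> 'v \<times> 3 \<Rightarrow> real" where
  "f2_entry T x j vk = partial_at (\<lambda>c. edge_length T (point_of c) j) (coords_of x) vk"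

text \<open>f_3 entry d omega_i / d l_j at the lengths coming from the coordinates.\<close>
definition f3_entry :: "('v,'e,'t) triang \<Rightarrow> ('v \<Rightarrow> real^3) \<Rightarrow> 'e \<Rightarrow> 'e \<Rightarrow> real" where
  "f3_entry T x i j = partial_at (deficit T x i) (edge_length T x) j"

text \<open>f_4 = - (f_2^D)^T.\<close>
definition f4_entry :: "('v,'e,'t) triang \<Rightarrow> ('v \<Rightarrow> real^3) \<Rightarrow> 'v \<times> 3 \<Rightarrow> 'e \<Rightarrow> real" where
  "f4_entry T x vk i = - f2_entry T x i vk"

end

theory Submission
  imports Defs
begin

text \<open>Moving the inner vertices changes the signed dihedral angle of a tetrahedron \<open>ABCD\<close> at \<open>AB\<close> by the
  difference of the speeds at which the faces \<open>ABD\<close> and \<open>ABC\<close> turn around \<open>AB\<close>. In the sum over all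
  tetrahedra around an edge the speed of an interior face occurs twice, with opposite signs because
  gluings reverse orientation, and the faces in the boundary do not move. So all \<open>\<omega>\<^sub>i\<close> and \<open>\<alpha>\<^sub>i\<close> are
  constant to first order, which by the chain rule is \<open>f\<^sub>3 \<circ> f\<^sub>2 = 0\<close>. Within one tetrahedron the matrix of
  partial derivatives of dihedral angles with respect to edge lengths is symmetric; hence
  \<open>f\<^sub>4 \<circ> f\<^sub>3\<close> is, up to sign, the transpose of \<open>f\<^sub>3 \<circ> f\<^sub>2\<close> with \<open>\<C>\<close> and \<open>\<D>\<close> exchanged.\<close>

section \<open>Dihedral angles as functions of squared edge lengths\<close>

text \<open>The lengths are independent variables, whereas the rotation argument speaks of moving
  points. One formula serves both: in squared lengths, a dihedral angle is the arccosine of a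
  polynomial over two square roots of polynomials, and its differential is linear in the velocities
  of the squared lengths. Unit velocities give the entries of \<open>f3_entry\<close>; velocities
  induced by moving vertices give a difference of two face speeds, because derivatives are unique. A
  triple \<open>(t, a, b)\<close> around an edge does not tell its two faces apart, and following
  the cycle of tetrahedra around an edge is awkward when simplices may be repeated. The sum is
  therefore spread over all vertex orders \<open>p\<close> of each tetrahedron: \<open>p 0\<close>
  and \<open>p 1\<close> span the edge, \<open>p 2\<close> selects a face. Crossing that face is an
  involution on pairs of a tetrahedron and a vertex order, and the sign of \<open>p\<close> records
  the orientation. Boundary edges keep their lengths when inner vertices move, so a sum over inner
  edges and \<open>C\<close> extends to all edges, where the chain rule applies.\<close>

text \<open>Below, \<open>S i j\<close> stands for the squared distance of the vertices \<open>i\<close> and \<open>j\<close> of a tetrahedron.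
  Then \<open>corner_dot\<close> is the scalar product of the edges \<open>ab\<close> and \<open>ac\<close>, \<open>heron\<close> is 4 times the squared
  area of \<open>abc\<close>, \<open>wedge\<close> is the scalar product of \<open>ab \<times> ac\<close> and \<open>ab \<times> ad\<close>, and \<open>gram\<close> is 36 times
  the squared volume.\<close>
definition corner_dot :: "(nat \<Rightarrow> nat \<Rightarrow> real) \<Rightarrow> nat \<Rightarrow> nat \<Rightarrow> nat \<Rightarrow> real" where
  "corner_dot S a b c = (S a b + S a c - S b c) / 2"

definition heron :: "(nat \<Rightarrow> nat \<Rightarrow> real) \<Rightarrow> nat \<Rightarrow> nat \<Rightarrow> nat \<Rightarrow> real" where
  "heron S a b c = S a b * S a c - (corner_dot S a b c)\<^sup>2"

definition wedge :: "(nat \<Rightarrow> nat \<Rightarrow> real) \<Rightarrow> nat \<Rightarrow> nat \<Rightarrow> nat \<Rightarrow> nat \<Rightarrow> real" where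
  "wedge S a b c d = corner_dot S a c d * S a b - corner_dot S a b c * corner_dot S a b d"

definition gram :: "(nat \<Rightarrow> nat \<Rightarrow> real) \<Rightarrow> nat \<Rightarrow> nat \<Rightarrow> nat \<Rightarrow> nat \<Rightarrow> real" where
  "gram S a b c d = S a b * S a c * S a d
     + 2 * corner_dot S a b c * corner_dot S a b d * corner_dot S a c d
     - S a b * (corner_dot S a c d)\<^sup>2 - S a c * (corner_dot S a b d)\<^sup>2
     - S a d * (corner_dot S a b c)\<^sup>2"

definition heron_rate ::
  "(nat \<Rightarrow> nat \<Rightarrow> real) \<Rightarrow> (nat \<Rightarrow> nat \<Rightarrow> real) \<Rightarrow> nat \<Rightarrow> nat \<Rightarrow> nat \<Rightarrow> real" where
  "heron_rate S S' a b c =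
     S' a b * S a c + S a b * S' a c - 2 * corner_dot S a b c * corner_dot S' a b c"

definition wedge_rate ::
  "(nat \<Rightarrow> nat \<Rightarrow> real) \<Rightarrow> (nat \<Rightarrow> nat \<Rightarrow> real) \<Rightarrow> nat \<Rightarrow> nat \<Rightarrow> nat \<Rightarrow> nat \<Rightarrow> real" where
  "wedge_rate S S' a b c d =
     corner_dot S' a c d * S a b + corner_dot S a c d * S' a b
     - corner_dot S' a b c * corner_dot S a b d - corner_dot S a b c * corner_dot S' a b d"

text \<open>Derivative of \<open>arccos (n / (sqrt p * sqrt q))\<close> for velocities
  \<open>n'\<close>, \<open>p'\<close>, \<open>q'\<close>, simplified so that a single root remains.
  Its radicand is the squared norm of a cross product when \<open>n\<close>, \<open>p\<close>,
  \<open>q\<close> are the scalar products of two vectors.\<close>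

definition arccos_ratio_rate :: "real \<Rightarrow> real \<Rightarrow> real \<Rightarrow> real \<Rightarrow> real \<Rightarrow> real \<Rightarrow> real" where
  "arccos_ratio_rate n p q n' p' q' =
     - (n' - n * p' / (2 * p) - n * q' / (2 * q)) / sqrt (p * q - n\<^sup>2)"

definition angle_rate ::
  "(nat \<Rightarrow> nat \<Rightarrow> real) \<Rightarrow> (nat \<Rightarrow> nat \<Rightarrow> real) \<Rightarrow> nat \<Rightarrow> nat \<Rightarrow> nat \<Rightarrow> nat \<Rightarrow> real" where
  "angle_rate S S' a b c d =
     arccos_ratio_rate (wedge S a b c d) (heron S a b c) (heron S a b d)
       (wedge_rate S S' a b c d) (heron_rate S S' a b c) (heron_rate S S' a b d)"

lemma arccos_ratio_has_derivative:
  fixes n p q :: "real \<Rightarrow> real"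
  assumes "(n has_real_derivative n') (at r)" "(p has_real_derivative p') (at r)"
    "(q has_real_derivative q') (at r)"
    and p: "0 < p r" and q: "0 < q r" and less: "(n r)\<^sup>2 < p r * q r"
  shows "((\<lambda>r. arccos (n r / (sqrt (p r) * sqrt (q r)))) has_real_derivative
           arccos_ratio_rate (n r) (p r) (q r) n' p' q') (at r)"
proof -
  define g where "g r = n r / (sqrt (p r) * sqrt (q r))" for r
  define g' where "g' = (n' - n r * p' / (2 * p r) - n r * q' / (2 * q r)) / (sqrt (p r) * sqrt (q r))"
  have sp: "sqrt (p r) > 0" "sqrt (q r) > 0" using p q by auto
  have pp: "sqrt (p r) * sqrt (p r) = p r" "sqrt (q r) * sqrt (q r) = q r" using p q by auto
  have dsp: "((\<lambda>r. sqrt (p r)) has_real_derivative p' / (2 * sqrt (p r))) (at r)"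
    by (rule derivative_eq_intros assms(2) refl | use p in \<open>simp add: field_simps\<close>)+
  have dsq: "((\<lambda>r. sqrt (q r)) has_real_derivative q' / (2 * sqrt (q r))) (at r)"
    by (rule derivative_eq_intros assms(3) refl | use q in \<open>simp add: field_simps\<close>)+
  have g: "(g has_real_derivative g') (at r)"
  proof -
    have "(g has_real_derivative
        (n' * (sqrt (p r) * sqrt (q r)) - n r * (p' / (2 * sqrt (p r)) * sqrt (q r)
           + q' / (2 * sqrt (q r)) * sqrt (p r)))
         / ((sqrt (p r) * sqrt (q r)) * (sqrt (p r) * sqrt (q r)))) (at r)"
      unfolding g_def using sp
      by (intro DERIV_divide DERIV_mult assms dsp dsq) auto
    moreover have "(n' * (sqrt (p r) * sqrt (q r)) - n r * (p' / (2 * sqrt (p r)) * sqrt (q r)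
           + q' / (2 * sqrt (q r)) * sqrt (p r)))
         / ((sqrt (p r) * sqrt (q r)) * (sqrt (p r) * sqrt (q r))) = g'"
      unfolding g'_def using sp pp
      by (simp add: field_simps)
    ultimately show ?thesis by simp
  qed
  have sq: "(g r)\<^sup>2 = (n r)\<^sup>2 / (p r * q r)"
    using p q by (simp add: g_def power_divide power_mult_distrib)
  then have "(g r)\<^sup>2 < 1"
    using p q less by simp
  then have "\<bar>g r\<bar> < 1"
    by (simp add: abs_square_less_1)
  then have "-1 < g r" "g r < 1" by auto
  then have d: "((\<lambda>r. arccos (g r)) has_real_derivative inverse (- sqrt (1 - (g r)\<^sup>2)) * g') (at r)"
    by (intro DERIV_chain2[OF DERIV_arccos g])
  have "1 - (g r)\<^sup>2 = (p r * q r - (n r)\<^sup>2) / (p r * q r)"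
    using p q unfolding sq by (simp add: field_simps)
  then have "sqrt (1 - (g r)\<^sup>2) = sqrt (p r * q r - (n r)\<^sup>2) / (sqrt (p r) * sqrt (q r))"
    by (simp add: real_sqrt_divide real_sqrt_mult)
  then have "inverse (- sqrt (1 - (g r)\<^sup>2)) * g' =
      arccos_ratio_rate (n r) (p r) (q r) n' p' q'"
    unfolding g'_def arccos_ratio_rate_def using sp less by (simp add: divide_simps)
  with d show ?thesis by (simp add: g_def)
qed

lemma heron_has_derivative:
  assumes "\<And>i j. ((\<lambda>r. S r i j) has_real_derivative S' i j) (at r)"
  shows "((\<lambda>r. heron (S r) a b c) has_real_derivative heron_rate (S r) S' a b c) (at r)"
  unfolding heron_def heron_rate_def corner_dot_def
  by (rule derivative_eq_intros assms refl | simp add: field_simps)+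

lemma wedge_has_derivative:
  assumes "\<And>i j. ((\<lambda>r. S r i j) has_real_derivative S' i j) (at r)"
  shows "((\<lambda>r. wedge (S r) a b c d) has_real_derivative wedge_rate (S r) S' a b c d) (at r)"
  unfolding wedge_def wedge_rate_def corner_dot_def
  by (rule derivative_eq_intros assms refl | simp add: field_simps)+

text \<open>Polynomial form of the fact that the cross product of the normals
  \<open>ab \<times> ac\<close> and \<open>ab \<times> ad\<close> is \<open>ab\<close> times six
  times the volume. The root in the rate of an angle at \<open>ab\<close> thus splits into the
  length of \<open>ab\<close> and a factor common to all six edges, which is what makes the symmetry
  visible.\<close>

lemma heron_mult_diff_wedge:
  "heron S a b c * heron S a b d - (wedge S a b c d)\<^sup>2 = S a b * gram S a b c d"
  unfolding heron_def wedge_def gram_def by algebra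

lemma heron_commute:
  assumes "\<And>i j. S i j = S j i"
  shows "heron S a c b = heron S a b c" "heron S b a c = heron S a b c"
  unfolding heron_def corner_dot_def
  using assms[of b a] assms[of c a] assms[of c b] by (simp_all add: field_simps power2_eq_square)

lemma heron_rate_commute:
  assumes "\<And>i j. S i j = S j i" "\<And>i j. S' i j = S' j i"
  shows "heron_rate S S' a c b = heron_rate S S' a b c"
    "heron_rate S S' b a c = heron_rate S S' a b c"
  unfolding heron_rate_def corner_dot_def
  using assms(1)[of b a] assms(1)[of c a] assms(1)[of c b]
    assms(2)[of b a] assms(2)[of c a] assms(2)[of c b] by (simp_all add: field_simps)

lemma wedge_commute:
  assumes "\<And>i j. S i j = S j i"
  shows "wedge S b a c d = wedge S a b c d" "wedge S a b d c = wedge S a b c d"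
  unfolding wedge_def corner_dot_def
  using assms[of b a] assms[of c a] assms[of d a] assms[of c b] assms[of d b] assms[of d c]
  by (simp_all add: field_simps)

lemma wedge_rate_commute:
  assumes "\<And>i j. S i j = S j i" "\<And>i j. S' i j = S' j i"
  shows "wedge_rate S S' b a c d = wedge_rate S S' a b c d"
    "wedge_rate S S' a b d c = wedge_rate S S' a b c d"
  unfolding wedge_rate_def corner_dot_def
  using assms(1)[of b a] assms(1)[of c a] assms(1)[of d a] assms(1)[of c b]
    assms(1)[of d b] assms(1)[of d c]
    assms(2)[of b a] assms(2)[of c a] assms(2)[of d a] assms(2)[of c b]
    assms(2)[of d b] assms(2)[of d c]
  by (simp_all add: field_simps)

lemma gram_commute:
  assumes "\<And>i j. S i j = S j i"
  shows "gram S b a c d = gram S a b c d" "gram S a c b d = gram S a b c d"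
    "gram S a b d c = gram S a b c d"
  unfolding gram_def corner_dot_def
  using assms[of b a] assms[of c a] assms[of d a] assms[of c b] assms[of d b] assms[of d c]
  by (simp_all add: field_simps power2_eq_square)

lemma angle_rate_commute:
  assumes "\<And>i j. S i j = S j i" "\<And>i j. S' i j = S' j i"
  shows "angle_rate S S' b a c d = angle_rate S S' a b c d"
    "angle_rate S S' a b d c = angle_rate S S' a b c d"
  unfolding angle_rate_def using assms
  by (simp_all add: heron_commute heron_rate_commute wedge_commute wedge_rate_commute
      arccos_ratio_rate_def algebra_simps)

text \<open>Linearity of the differential in the velocities, the algebraic half of the chain rule.
  For infinite \<open>E\<close> both sums are 0 by convention.\<close>

lemma angle_rate_sum:
  "angle_rate S (\<lambda>i j. \<Sum>e\<in>E. g e * S' e i j) a b c d = (\<Sum>e\<in>E. g e * angle_rate S (S' e) a b c d)"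
proof (cases "finite E")
  case True
  have zero: "angle_rate S (\<lambda>i j. 0) a b c d = 0"
    by (simp add: angle_rate_def arccos_ratio_rate_def heron_rate_def wedge_rate_def corner_dot_def)
  have add: "angle_rate S (\<lambda>i j. x * U i j + V i j) a b c d
      = x * angle_rate S U a b c d + angle_rate S V a b c d" for x U V
  proof -
    have c: "corner_dot (\<lambda>i j. x * U i j + V i j) a b c = x * corner_dot U a b c + corner_dot V a b c"
      for a b c by (simp add: corner_dot_def field_simps)
    have h: "heron_rate S (\<lambda>i j. x * U i j + V i j) a b c = x * heron_rate S U a b c + heron_rate S V a b c"
      for a b c unfolding heron_rate_def c by (simp add: algebra_simps)
    have w: "wedge_rate S (\<lambda>i j. x * U i j + V i j) a b c d = x * wedge_rate S U a b c d + wedge_rate S V a b c d"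
      unfolding wedge_rate_def c by (simp add: algebra_simps)
    show ?thesis
      unfolding angle_rate_def arccos_ratio_rate_def h w
      by (simp add: add_divide_distrib diff_divide_distrib algebra_simps)
  qed
  show ?thesis using True by induction (simp_all add: zero add)
qed (simp add: angle_rate_def arccos_ratio_rate_def heron_rate_def wedge_rate_def corner_dot_def)

text \<open>The velocity under which only the squared length of the edge \<open>ab\<close> grows.
  Comparing unordered pairs makes it symmetric in \<open>i\<close> and \<open>j\<close>.\<close>

definition pair_indicator :: "nat \<Rightarrow> nat \<Rightarrow> nat \<Rightarrow> nat \<Rightarrow> real" where
  "pair_indicator a b i j = (if {i, j} = {a, b} then 1 else 0)"

text \<open>Neither face at \<open>ab\<close> contains \<open>cd\<close>, so only the
  \<open>wedge\<close> term responds, at rate \<open>- S a b / 2\<close>; the rest is the symmetry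
  of \<open>gram\<close>. Since a squared length changes by twice the length times the change of the
  length, the outer factors turn this into the symmetry of derivatives by lengths, multiplied by
  half the product of the lengths of \<open>ab\<close> and \<open>cd\<close>.\<close>

lemma angle_rate_opposite:
  assumes "distinct [a, b, c, d]" "\<And>i j. S i j = S j i"
  shows "S c d * angle_rate S (pair_indicator c d) a b c d * sqrt (S a b)
       = S a b * angle_rate S (pair_indicator a b) c d a b * sqrt (S c d)"
proof -
  have h: "heron_rate S (pair_indicator c d) a b c = 0" "heron_rate S (pair_indicator c d) a b d = 0"
    "heron_rate S (pair_indicator a b) c d a = 0" "heron_rate S (pair_indicator a b) c d b = 0"
    using assms(1) by (auto simp: heron_rate_def corner_dot_def pair_indicator_def doubleton_eq_iff)
  have w: "wedge_rate S (pair_indicator c d) a b c d = - S a b / 2"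
     "wedge_rate S (pair_indicator a b) c d a b = - S c d / 2"
    using assms(1) by (auto simp: wedge_rate_def corner_dot_def pair_indicator_def doubleton_eq_iff)
  have g: "gram S c d a b = gram S a b c d"
    using gram_commute[of S] assms(2) by metis
  show ?thesis
    unfolding angle_rate_def arccos_ratio_rate_def h w heron_mult_diff_wedge g
    by (simp add: real_sqrt_mult)
qed

text \<open>Among the faces at \<open>ab\<close> only \<open>abc\<close> contains \<open>ac\<close>,
  and among those at \<open>ac\<close> only \<open>abc\<close> contains \<open>ab\<close>. Both
  rates therefore have the same denominators, \<open>heron S a b c\<close> and the root of
  \<open>gram\<close>, and their numerators can be compared.\<close>

lemma angle_rate_adjacent:
  assumes "distinct [a, b, c, d]" "\<And>i j. S i j = S j i" "heron S a b c \<noteq> 0" "S a c \<noteq> 0"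
  shows "S a c * angle_rate S (pair_indicator a c) a b c d * sqrt (S a b)
       = S a b * angle_rate S (pair_indicator a b) a c b d * sqrt (S a c)"
proof -
  have h: "heron_rate S (pair_indicator a c) a b d = 0" "heron_rate S (pair_indicator a b) a c d = 0"
    using assms(1) by (auto simp: heron_rate_def corner_dot_def pair_indicator_def doubleton_eq_iff)
  have h2: "heron_rate S (pair_indicator a c) a b c = S a b - corner_dot S a b c"
     "heron_rate S (pair_indicator a b) a c b = S a c - corner_dot S a b c"
    using assms(1) assms(2)[of c b]
    by (auto simp: heron_rate_def corner_dot_def pair_indicator_def doubleton_eq_iff)
  have w: "wedge_rate S (pair_indicator a c) a b c d = S a b / 2 - corner_dot S a b d / 2"
     "wedge_rate S (pair_indicator a b) a c b d = S a c / 2 - corner_dot S a c d / 2"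
    using assms(1) by (auto simp: wedge_rate_def corner_dot_def pair_indicator_def doubleton_eq_iff)
  have g: "gram S a c b d = gram S a b c d" and hc: "heron S a c b = heron S a b c"
    using gram_commute[of S] heron_commute[of S] assms(2) by metis+
  have key: "S a c * (wedge S a b c d * (S a b - corner_dot S a b c) / (2 * heron S a b c)
                 - (S a b / 2 - corner_dot S a b d / 2))
      = S a b * (wedge S a c b d * (S a c - corner_dot S a b c) / (2 * heron S a b c)
                 - (S a c / 2 - corner_dot S a c d / 2))"
  proof -
    \<comment> \<open>Clearing the denominator \<open>2 * heron S a b c\<close> leaves a polynomial
      identity in the squared lengths.\<close>
    have "S a c * ((S a b - corner_dot S a b d) * heron S a b c
                 - wedge S a b c d * (S a b - corner_dot S a b c))
      = S a b * ((S a c - corner_dot S a c d) * heron S a b c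
                 - wedge S a c b d * (S a c - corner_dot S a b c))"
      unfolding heron_def wedge_def corner_dot_def assms(2)[of c b]
      by (simp add: field_simps power2_eq_square)
    then show ?thesis using assms(3)
      by (simp add: field_simps)
  qed
  show ?thesis
    unfolding angle_rate_def arccos_ratio_rate_def h h2 w heron_mult_diff_wedge
    unfolding g hc using key assms(4) by (simp add: real_sqrt_mult)
qed

section \<open>Rotation of faces around an edge\<close>

definition signed_volume :: "('v \<Rightarrow> real^3) \<Rightarrow> 'v \<Rightarrow> 'v \<Rightarrow> 'v \<Rightarrow> 'v \<Rightarrow> real" where
  "signed_volume X a b c d = cross3 (X b - X a) (X c - X a) \<bullet> (X d - X a)"

definition face_normal :: "('v \<Rightarrow> real^3) \<Rightarrow> 'v \<Rightarrow> 'v \<Rightarrow> 'v \<Rightarrow> real^3" where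
  "face_normal X a b c = cross3 (X b - X a) (X c - X a)"

definition face_normal_rate ::
  "('v \<Rightarrow> real^3) \<Rightarrow> ('v \<Rightarrow> real^3) \<Rightarrow> 'v \<Rightarrow> 'v \<Rightarrow> 'v \<Rightarrow> real^3" where
  "face_normal_rate X X' a b c =
     cross3 (X b - X a) (X' c - X' a) + cross3 (X' b - X' a) (X c - X a)"

text \<open>The derivative of the unit normal of the face \<open>abc\<close> in the direction \<open>u \<times> n\<close>, where \<open>u\<close> is the unit
  vector along \<open>ab\<close> and \<open>n\<close> the unit normal: the speed at which the face turns around its edge \<open>ab\<close>.\<close>
definition face_rate ::
  "('v \<Rightarrow> real^3) \<Rightarrow> ('v \<Rightarrow> real^3) \<Rightarrow> 'v \<Rightarrow> 'v \<Rightarrow> 'v \<Rightarrow> real" where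
  "face_rate X X' a b c =
     face_normal_rate X X' a b c \<bullet> cross3 (X b - X a) (face_normal X a b c)
       / (dist (X a) (X b) * (face_normal X a b c \<bullet> face_normal X a b c))"

lemma bounded_bilinear_cross3: "bounded_bilinear cross3"
  using bilinear_cross bilinear_conv_bounded_bilinear by blast

lemma face_normal_has_derivative:
  assumes "\<And>v. ((\<lambda>r. X r v) has_vector_derivative X' v) (at r)"
  shows "((\<lambda>r. face_normal (X r) a b c) has_vector_derivative face_normal_rate (X r) X' a b c) (at r)"
  unfolding face_normal_def face_normal_rate_def
  by (intro bounded_bilinear.has_vector_derivative[OF bounded_bilinear_cross3]
      has_vector_derivative_diff assms)

lemma inner_has_real_derivative:
  fixes f g :: "real \<Rightarrow> 'a::real_inner"
  assumes "(f has_vector_derivative f') (at r)" "(g has_vector_derivative g') (at r)"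
  shows "((\<lambda>r. f r \<bullet> g r) has_real_derivative f r \<bullet> g' + f' \<bullet> g r) (at r)"
  unfolding has_real_derivative_iff_has_vector_derivative
  by (intro bounded_bilinear.has_vector_derivative[OF bounded_bilinear_inner] assms)

text \<open>Expansion of the double cross product: up to the factor \<open>m \<bullet> m\<close>,
  the part of \<open>q\<close> orthogonal to \<open>m\<close> is
  \<open>cross3 m (cross3 q m)\<close>.\<close>

lemma inner_diff_inner_self_cross:
  fixes m q n :: "real^3"
  shows "n \<bullet> q * (m \<bullet> m) - m \<bullet> q * (n \<bullet> m) = n \<bullet> cross3 m (cross3 q m)"
  by (simp add: Lagrange inner_diff_right inner_commute mult.commute)

text \<open>Everything rests on \<open>cross3 m q = \<Delta> *\<^sub>R u\<close>. It makes the
  radicand a square with root \<open>\<bar>\<Delta>\<bar> * norm u\<close>, and it turns the part of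
  \<open>q\<close> orthogonal to \<open>m\<close> into a multiple of \<open>\<Delta>\<close> along
  \<open>cross3 u m\<close>. The remaining quotient of \<open>\<Delta>\<close> by its absolute value
  is cancelled by the sign of the angle, so the term of each face no longer refers to the other
  face.\<close>

lemma sgn_arccos_ratio_rate:
  fixes u w z m' q' :: "real^3"
  defines "m \<equiv> cross3 u w" and "q \<equiv> cross3 u z" and "\<Delta> \<equiv> cross3 u w \<bullet> z"
  assumes "\<Delta> \<noteq> 0"
  shows "sgn \<Delta> * arccos_ratio_rate (m \<bullet> q) (m \<bullet> m) (q \<bullet> q)
             (m \<bullet> q' + m' \<bullet> q) (m \<bullet> m' + m' \<bullet> m) (q \<bullet> q' + q' \<bullet> q)
       = q' \<bullet> cross3 u q / (norm u * (q \<bullet> q)) - m' \<bullet> cross3 u m / (norm u * (m \<bullet> m))"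
    and "m \<bullet> m > 0" and "q \<bullet> q > 0" and "(m \<bullet> q)\<^sup>2 < (m \<bullet> m) * (q \<bullet> q)"
proof -
  have mq: "cross3 m q = \<Delta> *\<^sub>R u"
    unfolding m_def q_def \<Delta>_def cross_cross_det
    by (simp add: det_identical_rows dot_cross_det[symmetric] dot_cross_self)
      (simp add: cross3_simps)
  have u: "u \<noteq> 0" using assms(4) unfolding \<Delta>_def by auto
  have "m \<noteq> 0" using assms(4) unfolding \<Delta>_def m_def by auto
  then show m: "m \<bullet> m > 0" by simp
  have "q \<noteq> 0" using assms(4) unfolding \<Delta>_def q_def cross_triple[of u w z]
    by (metis cross_skew cross_triple inner_zero_left neg_0_equal_iff_equal)
  then show q: "q \<bullet> q > 0" by simp
  have rad: "(m \<bullet> m) * (q \<bullet> q) - (m \<bullet> q)\<^sup>2 = (\<Delta> * norm u)\<^sup>2"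
  proof -
    have "(m \<bullet> m) * (q \<bullet> q) - (m \<bullet> q)\<^sup>2 = (norm (cross3 m q))\<^sup>2"
      using norm_cross[of m q] by (simp only: power2_norm_eq_inner)
    also have "\<dots> = (\<Delta> * norm u)\<^sup>2" unfolding mq by (simp add: power_mult_distrib)
    finally show ?thesis .
  qed
  moreover have "(\<Delta> * norm u)\<^sup>2 > 0" using assms(4) u by simp
  ultimately show "(m \<bullet> q)\<^sup>2 < (m \<bullet> m) * (q \<bullet> q)" by linarith
  have qm: "cross3 q m = - \<Delta> *\<^sub>R u"
    using mq cross_skew[of q m] by simp
  have e1: "m' \<bullet> q * (m \<bullet> m) - m \<bullet> q * (m' \<bullet> m) = \<Delta> * (m' \<bullet> cross3 u m)"
    unfolding inner_diff_inner_self_cross qm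
    by (simp add: cross_mult_right cross_skew[of m u])
  have e2: "m \<bullet> q' * (q \<bullet> q) - m \<bullet> q * (q' \<bullet> q) = - \<Delta> * (q' \<bullet> cross3 u q)"
    using inner_diff_inner_self_cross[of q' m q] unfolding mq
    by (simp add: cross_mult_right cross_skew[of q u] inner_commute)
  \<comment> \<open>Sorting by velocities: one summand contains only \<open>m'\<close>, the other
    only \<open>q'\<close>.\<close>
  have "m \<bullet> q' + m' \<bullet> q - m \<bullet> q * (m \<bullet> m' + m' \<bullet> m) / (2 * (m \<bullet> m))
      - m \<bullet> q * (q \<bullet> q' + q' \<bullet> q) / (2 * (q \<bullet> q))
    = (m' \<bullet> q * (m \<bullet> m) - m \<bullet> q * (m' \<bullet> m)) / (m \<bullet> m)
      + (m \<bullet> q' * (q \<bullet> q) - m \<bullet> q * (q' \<bullet> q)) / (q \<bullet> q)"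
    using m q by (simp add: field_simps inner_commute)
  also have "\<dots> = \<Delta> * (m' \<bullet> cross3 u m / (m \<bullet> m) - q' \<bullet> cross3 u q / (q \<bullet> q))"
    unfolding e1 e2 by (simp add: algebra_simps)
  finally have num: "m \<bullet> q' + m' \<bullet> q - m \<bullet> q * (m \<bullet> m' + m' \<bullet> m) / (2 * (m \<bullet> m))
      - m \<bullet> q * (q \<bullet> q' + q' \<bullet> q) / (2 * (q \<bullet> q))
    = \<Delta> * (m' \<bullet> cross3 u m / (m \<bullet> m) - q' \<bullet> cross3 u q / (q \<bullet> q))" .
  have "arccos_ratio_rate (m \<bullet> q) (m \<bullet> m) (q \<bullet> q)
        (m \<bullet> q' + m' \<bullet> q) (m \<bullet> m' + m' \<bullet> m) (q \<bullet> q' + q' \<bullet> q)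
      = \<Delta> * (q' \<bullet> cross3 u q / (q \<bullet> q) - m' \<bullet> cross3 u m / (m \<bullet> m)) / (\<bar>\<Delta>\<bar> * norm u)"
    unfolding arccos_ratio_rate_def rad num by (simp add: abs_mult right_diff_distrib)
  moreover have "sgn \<Delta> * (\<Delta> * y / (\<bar>\<Delta>\<bar> * norm u)) = y / norm u" for y
    using assms(4) by (simp add: sgn_real_def abs_if)
  ultimately show "sgn \<Delta> * arccos_ratio_rate (m \<bullet> q) (m \<bullet> m) (q \<bullet> q)
             (m \<bullet> q' + m' \<bullet> q) (m \<bullet> m' + m' \<bullet> m) (q \<bullet> q' + q' \<bullet> q)
       = q' \<bullet> cross3 u q / (norm u * (q \<bullet> q)) - m' \<bullet> cross3 u m / (norm u * (m \<bullet> m))"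
    by (simp only:) (simp add: diff_divide_distrib mult.commute)
qed

text \<open>The rate of change of a signed dihedral angle splits into one contribution of each of the two
  faces at the edge.\<close>
lemma signed_angle_has_derivative:
  fixes X :: "real \<Rightarrow> 'v \<Rightarrow> real^3"
  assumes X: "\<And>v. ((\<lambda>r. X r v) has_vector_derivative X' v) (at r)"
    and vol: "signed_volume (X r) a b c d \<noteq> 0"
  shows "((\<lambda>s. sgn (signed_volume (X r) a b c d) *
            arccos (face_normal (X s) a b c \<bullet> face_normal (X s) a b d
               / (sqrt (face_normal (X s) a b c \<bullet> face_normal (X s) a b c)
                  * sqrt (face_normal (X s) a b d \<bullet> face_normal (X s) a b d))))
          has_real_derivative face_rate (X r) X' a b d - face_rate (X r) X' a b c) (at r)"
proof -
  define u w z where "u = X r b - X r a" and "w = X r c - X r a" and "z = X r d - X r a"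
  have vol': "cross3 u w \<bullet> z \<noteq> 0"
    using vol by (simp add: signed_volume_def u_def w_def z_def)
  note * = sgn_arccos_ratio_rate[OF vol']
  note n = face_normal_has_derivative[where X=X, OF X]
  have fr: "face_rate (X r) X' a b d - face_rate (X r) X' a b c
    = sgn (signed_volume (X r) a b c d) * arccos_ratio_rate
        (face_normal (X r) a b c \<bullet> face_normal (X r) a b d)
        (face_normal (X r) a b c \<bullet> face_normal (X r) a b c)
        (face_normal (X r) a b d \<bullet> face_normal (X r) a b d)
        (face_normal (X r) a b c \<bullet> face_normal_rate (X r) X' a b d
          + face_normal_rate (X r) X' a b c \<bullet> face_normal (X r) a b d)
        (face_normal (X r) a b c \<bullet> face_normal_rate (X r) X' a b c
          + face_normal_rate (X r) X' a b c \<bullet> face_normal (X r) a b c)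
        (face_normal (X r) a b d \<bullet> face_normal_rate (X r) X' a b d
          + face_normal_rate (X r) X' a b d \<bullet> face_normal (X r) a b d)"
    using *(1)[of "face_normal_rate (X r) X' a b d" "face_normal_rate (X r) X' a b c"]
    unfolding face_rate_def signed_volume_def face_normal_def u_def w_def z_def
    by (simp add: dist_norm norm_minus_commute)
  show ?thesis unfolding fr
    by (intro DERIV_cmult arccos_ratio_has_derivative inner_has_real_derivative n)
      (use *(2-4) in \<open>simp_all add: face_normal_def u_def w_def z_def\<close>)
qed

section \<open>Squared lengths, face normals and volumes in terms of coordinates\<close>

lemma corner_dot_dist:
  "corner_dot (\<lambda>i j. (dist (P i) (P j))\<^sup>2) a b c = (P b - P a) \<bullet> (P c - P a)"
  unfolding corner_dot_def dist_norm power2_norm_eq_inner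
  by (simp add: inner_diff_left inner_diff_right inner_commute field_simps)

text \<open>The Binet-Cauchy identity for scalar products of cross products.\<close>

lemma wedge_dist:
  "wedge (\<lambda>i j. (dist (P i) (P j))\<^sup>2) a b c d = face_normal P a b c \<bullet> face_normal P a b d"
  unfolding wedge_def corner_dot_dist face_normal_def dot_cross
  by (simp add: dist_norm power2_norm_eq_inner inner_commute)
    (simp add: inner_diff_left inner_diff_right inner_commute algebra_simps)

lemma heron_dist:
  "heron (\<lambda>i j. (dist (P i) (P j))\<^sup>2) a b c = face_normal P a b c \<bullet> face_normal P a b c"
  unfolding heron_def corner_dot_dist face_normal_def dot_cross
  unfolding dist_norm power2_norm_eq_inner unfolding power2_eq_square
  by (simp add: inner_diff_left inner_diff_right inner_commute algebra_simps)

text \<open>Induction over transpositions. The labelling \<open>f\<close> stays arbitrary because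
  the outer transposition is absorbed into it before the induction hypothesis is applied.\<close>

lemma signed_volume_permute:
  assumes "p permutes {..<4}"
  shows "signed_volume X (f (p 0)) (f (p 1)) (f (p 2)) (f (p (3::nat)))
       = of_int (sign p) * signed_volume X (f 0) (f 1) (f 2) (f 3)"
  using assms finite_lessThan
proof (induction arbitrary: f rule: permutes_induct)
  case id
  then show ?case by simp
next
  case (swap a b p)
  have s: "sign (Transposition.transpose a b \<circ> p) = - sign p"
    using swap by (simp add: sign_compose sign_swap_id permutation_swap_id permutes_imp_permutation[of "{..<4}"])
  have ab: "a < 4" "b < 4" "a \<noteq> b" using swap by auto
  have lt: "n < 4 \<longleftrightarrow> n = 0 \<or> n = 1 \<or> n = 2 \<or> n = 3" for n :: nat by auto
  have "signed_volume X (f (Transposition.transpose a b 0)) (f (Transposition.transpose a b 1)) (f (Transposition.transpose a b 2))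
      (f (Transposition.transpose a b 3)) = - signed_volume X (f 0) (f 1) (f 2) (f 3)"
    using ab unfolding lt
    by (auto simp: Transposition.transpose_def signed_volume_def inner_vec_def sum_3 cross_components algebra_simps)
  then show ?case
    using swap.IH[of "f \<circ> Transposition.transpose a b"] unfolding s by simp
qed

lemma signed_volume_nonzero:
  fixes X :: "'v \<Rightarrow> real^3"
  assumes inj: "inj_on X {a, b, c, d}" and distinct: "distinct [a, b, c, d]"
    and indep: "\<not> affine_dependent (X ` {a, b, c, d})"
  shows "signed_volume X a b c d \<noteq> 0"
proof
  assume zero: "signed_volume X a b c d = 0"
  define M :: "real^3^3" where "M = vector [X b - X a, X c - X a, X d - X a]"
  have "det M = 0"
    using zero unfolding M_def dot_cross_det[symmetric] signed_volume_def
    by (metis cross_triple inner_commute)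
  then have "\<not> invertible M" by (simp add: invertible_det_nz)
  then have "\<not> (\<exists>B. M ** B = mat 1)"
    using invertible_right_inverse by blast
  then obtain k where k: "(\<Sum>i\<in>UNIV. k i *s row i M) = 0" "\<exists>i. k i \<noteq> 0"
    unfolding matrix_right_invertible_independent_rows by blast
  have rows: "row 1 M = X b - X a" "row 2 M = X c - X a" "row 3 M = X d - X a"
    unfolding M_def row_def by (simp_all add: vec_eq_iff)
  have dep: "k 1 *\<^sub>R (X b - X a) + k 2 *\<^sub>R (X c - X a) + k 3 *\<^sub>R (X d - X a) = 0"
    using k(1) by (simp add: sum_3 rows scalar_mult_eq_scaleR)
  have dist: "X a \<noteq> X b" "X a \<noteq> X c" "X a \<noteq> X d" "X b \<noteq> X c" "X b \<noteq> X d" "X c \<noteq> X d"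
    using inj distinct by (auto simp: inj_on_def)
  \<comment> \<open>The linear relation between the edge vectors becomes an affine relation between
    the points once \<open>X a\<close> receives the coefficient that makes the total 0. Distinctness
    of the points makes \<open>U\<close> well defined on points instead of vertices.\<close>
  define U where "U p = (if p = X b then k 1 else if p = X c then k 2 else if p = X d then k 3
      else - (k 1 + k 2 + k 3))" for p
  have U: "U (X a) = - (k 1 + k 2 + k 3)" "U (X b) = k 1" "U (X c) = k 2" "U (X d) = k 3"
    using dist by (auto simp: U_def)
  have "sum U (X ` {a, b, c, d}) = 0"
    using dist by (simp add: U)
  moreover have "(\<Sum>p\<in>X ` {a, b, c, d}. U p *\<^sub>R p) = 0"
    using dist dep by (simp add: U algebra_simps)
  moreover have "\<exists>p\<in>X ` {a, b, c, d}. U p \<noteq> 0"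
    using k(2) forall_3[of "\<lambda>i. k i = 0"] by (auto simp: U)
  ultimately have "affine_dependent (X ` {a, b, c, d})"
    by (subst affine_dependent_explicit_finite) auto
  with indep show False by simp
qed

section \<open>Symmetry of the derivatives of dihedral angles\<close>

lemma remaining_positions:
  assumes "distinct [a, b, c, d]" "{a, b, c, d} \<subseteq> {..<4::nat}"
  shows "{..<4} - {a, b} = {c, d}"
proof -
  have "card {a, b, c, d} = 4" using assms(1) by simp
  then have "{a, b, c, d} = {..<4}" using assms(2) by (intro card_subset_eq) auto
  then show ?thesis using assms(1) by auto
qed

lemma fourth_position_exists:
  assumes "distinct [a, b, c]" "{a, b, c} \<subseteq> {..<4::nat}"
  shows "\<exists>d. distinct [a, b, c, d] \<and> {a, b, c, d} \<subseteq> {..<4}"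
proof -
  have "card {a, b, c} = 3" using assms(1) by simp
  then have "\<not> {..<4} \<subseteq> {a, b, c}" using card_mono[of "{a, b, c}" "{..<4}"] by auto
  then obtain d where "d < 4" "d \<notin> {a, b, c}" by blast
  then show ?thesis using assms by (intro exI[of _ d]) auto
qed

lemma remaining_positions_exist:
  assumes "a \<noteq> b" "a < 4" "b < (4::nat)"
  shows "\<exists>c d. distinct [a, b, c, d] \<and> {a, b, c, d} \<subseteq> {..<4}"
proof -
  have "card {a, b} = 2" using assms(1) by simp
  then have "\<not> {..<4} \<subseteq> {a, b}" using card_mono[of "{a, b}" "{..<4}"] by auto
  then obtain c where "c < 4" "c \<notin> {a, b}" by blast
  then have "distinct [a, b, c]" "{a, b, c} \<subseteq> {..<4}" using assms by auto
  from fourth_position_exists[OF this] show ?thesis by blast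
qed

text \<open>The remaining positions are picked as in \<open>dihedral_angle\<close>; by
  \<open>angle_rate_commute\<close> their order does not affect the value.\<close>

definition edge_angle_rate ::
  "(nat \<Rightarrow> nat \<Rightarrow> real) \<Rightarrow> (nat \<Rightarrow> nat \<Rightarrow> real) \<Rightarrow> nat \<Rightarrow> nat \<Rightarrow> real" where
  "edge_angle_rate S S' a b = angle_rate S S' a b (Min ({..<4} - {a, b})) (Max ({..<4} - {a, b}))"

lemma edge_angle_rate_eq:
  assumes "\<And>i j. S i j = S j i" "\<And>i j. S' i j = S' j i"
    and "distinct [a, b, c, d]" "{a, b, c, d} \<subseteq> {..<4}"
  shows "edge_angle_rate S S' a b = angle_rate S S' a b c d"
  unfolding edge_angle_rate_def remaining_positions[OF assms(3,4)]
  using angle_rate_commute[of S S', OF assms(1,2)] by (auto simp: min_def max_def)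

lemma edge_angle_rate_commute:
  assumes "\<And>i j. S i j = S j i" "\<And>i j. S' i j = S' j i"
  shows "edge_angle_rate S S' a b = edge_angle_rate S S' b a"
  unfolding edge_angle_rate_def
  using angle_rate_commute[of S S', OF assms(1,2)] by (simp add: insert_commute)

lemma edge_angle_rate_sum:
  "edge_angle_rate S (\<lambda>i j. \<Sum>e\<in>E. g e * S' e i j) a b = (\<Sum>e\<in>E. g e * edge_angle_rate S (S' e) a b)"
  unfolding edge_angle_rate_def by (rule angle_rate_sum)

lemma pair_indicator_sym: "pair_indicator a b i j = pair_indicator a b j i"
  by (simp add: pair_indicator_def insert_commute)

lemma pair_indicator_commute: "pair_indicator b a = pair_indicator a b"
  by (simp add: pair_indicator_def insert_commute fun_eq_iff)

text \<open>Up to the common factor 2, both sides are partial derivatives of a dihedral angle with respect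
  to an edge length.\<close>
lemma edge_angle_rate_symmetric:
  fixes S :: "nat \<Rightarrow> nat \<Rightarrow> real"
  assumes S: "\<And>i j. S i j = S j i"
    and pos: "\<And>i j. i < 4 \<Longrightarrow> j < 4 \<Longrightarrow> i \<noteq> j \<Longrightarrow> S i j > 0"
    and heron: "\<And>i j k. distinct [i, j, k] \<Longrightarrow> {i, j, k} \<subseteq> {..<4} \<Longrightarrow> heron S i j k \<noteq> 0"
    and ab: "a < b" "b < 4" and cd: "c < d" "d < 4"
  shows "sqrt (S c d) * edge_angle_rate S (pair_indicator c d) a b
       = sqrt (S a b) * edge_angle_rate S (pair_indicator a b) c d"
proof -
  \<comment> \<open>\<open>R\<close> is half the derivative of the angle at \<open>ab\<close> by the
    length of \<open>cd\<close>. Since the ends of each edge may be swapped, only opposite edges and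
    edges with a common first vertex have to be treated.\<close>
  define R where "R a b c d = sqrt (S c d) * edge_angle_rate S (pair_indicator c d) a b" for a b c d
  have R1: "R b a c d = R a b c d" for a b c d
    using edge_angle_rate_commute[of S "pair_indicator c d" b a, OF S pair_indicator_sym]
    by (simp add: R_def)
  have R2: "R a b d c = R a b c d" for a b c d
    by (simp only: R_def pair_indicator_commute[of d c] S[of d c])
  note eq = edge_angle_rate_eq[of S, OF S pair_indicator_sym]
  \<comment> \<open>Division by the product of the two roots brings
    \<open>angle_rate_opposite\<close> and \<open>angle_rate_adjacent\<close> into the form of
    \<open>R\<close>.\<close>
  have cancel: "sqrt p * y = sqrt q * z" if "p * y * sqrt q = q * z * sqrt p" "p > 0" "q > 0" for p q y z
  proof -
    have "x * y = w * z" if "x * x * y * w = w * w * z * x" "x \<noteq> 0" "w \<noteq> 0" for x w :: real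
    proof -
      have "x * y * (x * w) = w * z * (x * w)" using that(1) by (simp only: ac_simps)
      then show ?thesis using that by simp
    qed
    from this[of "sqrt p" "sqrt q"] show ?thesis using that by simp
  qed
  have opposite: "R a b c d = R c d a b" if "distinct [a, b, c, d]" "{a, b, c, d} \<subseteq> {..<4}" for a b c d
  proof -
    have d: "distinct [c, d, a, b]" "{c, d, a, b} \<subseteq> {..<4}" using that by auto
    show ?thesis
      unfolding R_def eq[OF that] eq[OF d]
    proof (rule cancel)
      show "S c d > 0" "S a b > 0" using that by (auto intro: pos)
    qed (rule angle_rate_opposite[OF that(1) S])
  qed
  have adjacent: "R a b a c = R a c a b" if abc: "distinct [a, b, c]" "{a, b, c} \<subseteq> {..<4}" for a b c
  proof -
    obtain d where d: "distinct [a, b, c, d]" "{a, b, c, d} \<subseteq> {..<4}"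
      using fourth_position_exists[OF abc] by blast
    then have d': "distinct [a, c, b, d]" "{a, c, b, d} \<subseteq> {..<4}" by auto
    have ac: "S a c > 0" and ab: "S a b > 0" using pos[of a c] pos[of a b] abc by auto
    show ?thesis
      unfolding R_def eq[OF d] eq[OF d']
    proof (rule cancel)
      show "S a c * angle_rate S (pair_indicator a c) a b c d * sqrt (S a b)
          = S a b * angle_rate S (pair_indicator a b) a c b d * sqrt (S a c)"
        using ac by (intro angle_rate_adjacent[OF d(1) S heron[OF abc]]) simp
    qed (fact ac ab)+
  qed
  have "R a b c d = R c d a b"
  proof (cases "{a, b} \<inter> {c, d} = {}")
    case True
    then show ?thesis using ab cd by (intro opposite) auto
  next
    case False
    then consider "a = c" "b = d" | "a = c" "b \<noteq> d" | "a = d" | "b = c" | "b = d" "a \<noteq> c"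
      by auto
    then show ?thesis
    proof cases
      case 1 then show ?thesis by simp
    next
      case 2 then show ?thesis using adjacent[of a b d] ab cd by auto
    next
      case 3 then show ?thesis using adjacent[of a b c] ab cd by (auto simp: R1 R2)
    next
      case 4 then show ?thesis using adjacent[of b a d] ab cd by (auto simp: R1 R2)
    next
      case 5 then show ?thesis using adjacent[of b a c] ab cd by (auto simp: R1 R2)
    qed
  qed
  then show ?thesis by (simp add: R_def)
qed

section \<open>Summation over the vertex orders of a tetrahedron\<close>

definition pairs :: "(nat \<times> nat) set" where
  "pairs = {(a, b). a < b \<and> b < 4}"

lemma finite_pairs: "finite pairs"
  by (rule finite_subset[of _ "{..<4} \<times> {..<4}"]) (auto simp: pairs_def)

text \<open>Vertex orders are grouped by the edge \<open>{p 0, p 1}\<close>. Composition with a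
  permutation that carries \<open>{0, 1}\<close> to \<open>{a, b}\<close> is a bijection between
  groups, so all have the same size \<open>K\<close>; for cancelling \<open>K\<close> later its
  positivity suffices.\<close>

lemma sum_permutations_pairs:
  fixes h :: "nat \<Rightarrow> nat \<Rightarrow> real"
  defines "K \<equiv> card {p. p permutes {..<4::nat} \<and> {p 0, p 1} = {0, 1}}"
  assumes h: "\<And>a b. a < 4 \<Longrightarrow> b < 4 \<Longrightarrow> a \<noteq> b \<Longrightarrow> h a b = h b a"
  shows "(\<Sum>p | p permutes {..<4::nat}. h (p 0) (p 1)) = K * (\<Sum>(a, b)\<in>pairs. h a b)"
proof -
  define P where "P = {p. p permutes {..<4::nat}}"
  have fin: "finite P" unfolding P_def by (rule finite_permutations) simp
  have lt: "p 0 < 4" "p 1 < 4" "p 0 \<noteq> p 1" if "p \<in> P" for p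
    using that permutes_in_image[of p "{..<4}"] permutes_inj[of p "{..<4}"]
    by (auto simp: P_def inj_eq)
  define g where "g p = (min (p 0) (p 1), max (p 0) (p 1))" for p :: "nat \<Rightarrow> nat"
  have fibre: "{p \<in> P. g p = (a, b)} = {p \<in> P. {p 0, p 1} = {a, b}}" if "a < b" for a b
    using that by (auto simp: g_def min_def max_def doubleton_eq_iff split: if_splits)
  have card: "card {p \<in> P. {p 0, p 1} = {a, b}} = K" if "(a, b) \<in> pairs" for a b
  proof -
    have ab: "a < b" "b < 4" using that by (auto simp: pairs_def)
    \<comment> \<open>\<open>b'\<close> is the position that the outer transposition of
      \<open>q\<close> sends to \<open>b\<close>. Hence \<open>q\<close> maps 1 to \<open>b\<close>,
      and 0 to \<open>a\<close> because \<open>b'\<close> differs from 0.\<close>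
    define b' where "b' = Transposition.transpose 0 a b"
    define q where "q = Transposition.transpose 0 a \<circ> Transposition.transpose 1 b'"
    have b': "b' \<noteq> 0" "b' < 4" using ab by (auto simp: b'_def Transposition.transpose_def)
    have q: "q permutes {..<4}"
      unfolding q_def using ab b' by (intro permutes_compose permutes_swap_id) auto
    have q01: "q 0 = a" "q 1 = b"
      using b' by (auto simp: q_def transpose_apply_other) (simp add: b'_def)
    have "bij_betw (\<lambda>p. q \<circ> p) {p \<in> P. {p 0, p 1} = {0, 1}} {p \<in> P. {p 0, p 1} = {a, b}}"
    proof (rule bij_betw_byWitness[where f' = "\<lambda>p. inv q \<circ> p"])
      show "\<forall>p\<in>{p \<in> P. {p 0, p 1} = {0, 1}}. inv q \<circ> (q \<circ> p) = p"
        using permutes_inv_o(2)[OF q] by (simp add: o_assoc)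
      show "\<forall>p\<in>{p \<in> P. {p 0, p 1} = {a, b}}. q \<circ> (inv q \<circ> p) = p"
        using permutes_inv_o(1)[OF q] by (simp add: o_assoc)
      show "(\<lambda>p. q \<circ> p) ` {p \<in> P. {p 0, p 1} = {0, 1}} \<subseteq> {p \<in> P. {p 0, p 1} = {a, b}}"
        using q q01 by (auto simp: P_def doubleton_eq_iff intro: permutes_compose)
      have inv01: "inv q a = 0" "inv q b = 1"
        using q01 permutes_inverses(2)[OF q] by metis+
      show "(\<lambda>p. inv q \<circ> p) ` {p \<in> P. {p 0, p 1} = {a, b}} \<subseteq> {p \<in> P. {p 0, p 1} = {0, 1}}"
        using permutes_inv[OF q] inv01 by (auto simp: P_def doubleton_eq_iff intro: permutes_compose)
    qed
    from bij_betw_same_card[OF this] show ?thesis by (simp add: K_def P_def)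
  qed
  have "(\<Sum>p\<in>P. h (p 0) (p 1)) = (\<Sum>y\<in>pairs. \<Sum>p\<in>{p \<in> P. g p = y}. h (p 0) (p 1))"
  proof (rule sum.group[symmetric, OF fin finite_pairs])
    show "g ` P \<subseteq> pairs"
    proof (rule image_subsetI)
      fix p assume "p \<in> P"
      from lt[OF this] show "g p \<in> pairs" by (auto simp: g_def pairs_def min_def max_def)
    qed
  qed
  also have "\<dots> = (\<Sum>(a, b)\<in>pairs. K * h a b)"
  proof (rule sum.cong[OF refl], clarify)
    fix a b assume ab: "(a, b) \<in> pairs"
    have "h (p 0) (p 1) = h a b" if "p \<in> P" "{p 0, p 1} = {a, b}" for p
      using that h lt[OF that(1)] by (auto simp: doubleton_eq_iff)
    then have "(\<Sum>p\<in>{p \<in> P. {p 0, p 1} = {a, b}}. h (p 0) (p 1))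
        = (\<Sum>p\<in>{p \<in> P. {p 0, p 1} = {a, b}}. h a b)"
      by (intro sum.cong) auto
    then show "(\<Sum>p\<in>{p \<in> P. g p = (a, b)}. h (p 0) (p 1)) = K * h a b"
      using ab fibre[of a b] card[OF ab] by (auto simp: pairs_def)
  qed
  finally show "(\<Sum>p | p permutes {..<4::nat}. h (p 0) (p 1)) = K * (\<Sum>(a, b)\<in>pairs. h a b)"
    by (simp add: P_def sum_distrib_left case_prod_unfold)
qed

lemma card_pair_stabilizer_pos: "card {p. p permutes {..<4::nat} \<and> {p 0, p 1} = {0, 1}} > 0"
proof -
  define Q where "Q = {p. p permutes {..<4::nat} \<and> {p 0, p 1} = {0, 1}}"
  have "id \<in> Q" by (simp add: Q_def permutes_id)
  moreover have "finite Q"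
    by (rule finite_subset[OF _ finite_permutations[of "{..<4}"]]) (auto simp: Q_def)
  ultimately have "card Q > 0" unfolding card_gt_0_iff by blast
  then show ?thesis by (simp add: Q_def)
qed

text \<open>Reindexing by \<phi> shows that the sum equals its own negative; at a fixed point
  \<open>F\<close> vanishes anyway.\<close>

lemma sum_eq_0_if_odd_involution:
  fixes F :: "'a \<Rightarrow> real"
  assumes "\<And>z. z \<in> A \<Longrightarrow> \<phi> z \<in> A" "\<And>z. z \<in> A \<Longrightarrow> \<phi> (\<phi> z) = z" "\<And>z. z \<in> A \<Longrightarrow> F (\<phi> z) = - F z"
  shows "sum F A = 0"
proof -
  have "sum F A = (\<Sum>z\<in>A. - F z)"
    by (rule sum.reindex_bij_witness[of A \<phi> \<phi>]) (use assms in auto)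
  then show ?thesis by (simp add: sum_negf)
qed

lemma permutes_lessThan_4:
  assumes "p permutes {..<4::nat}"
  shows "distinct [p 0, p 1, p 2, p 3]" "{p 0, p 1, p 2, p 3} \<subseteq> {..<4}"
  using permutes_inj[OF assms] permutes_in_image[OF assms] by (auto simp: inj_eq)

section \<open>Edge lengths of one tetrahedron as squared distances of its positions\<close>

lemma wedge_cong:
  assumes "\<And>i j. i \<noteq> j \<Longrightarrow> i \<in> {a, b, c, d} \<Longrightarrow> j \<in> {a, b, c, d} \<Longrightarrow> S i j = U i j"
    and "distinct [a, b, c, d]"
  shows "wedge S a b c d = wedge U a b c d"
  using assms(2) by (simp add: wedge_def corner_dot_def assms(1))

lemma heron_cong:
  assumes "\<And>i j. i \<noteq> j \<Longrightarrow> i \<in> {a, b, c} \<Longrightarrow> j \<in> {a, b, c} \<Longrightarrow> S i j = U i j"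
    and "distinct [a, b, c]"
  shows "heron S a b c = heron U a b c"
  using assms(2) by (simp add: heron_def corner_dot_def assms(1))

text \<open>\<open>te\<close> is constrained only at two different positions below 4. The default 0
  makes the function symmetric in all its arguments, as the lemmas about squared lengths
  require.\<close>

definition on_edges :: "('v,'e,'t) triang \<Rightarrow> 't \<Rightarrow> ('e \<Rightarrow> real) \<Rightarrow> nat \<Rightarrow> nat \<Rightarrow> real" where
  "on_edges T t f i j = (if i < 4 \<and> j < 4 \<and> i \<noteq> j then f (te T t i j) else 0)"

definition dihedral_rate ::
  "('v,'e,'t) triang \<Rightarrow> 't \<Rightarrow> ('e \<Rightarrow> real) \<Rightarrow> ('e \<Rightarrow> real) \<Rightarrow> nat \<Rightarrow> nat \<Rightarrow> real" where
  "dihedral_rate T t L L' = edge_angle_rate (on_edges T t (\<lambda>e. (L e)\<^sup>2)) (on_edges T t (\<lambda>e. 2 * L e * L' e))"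

text \<open>Removes the lengths from the spherical law of cosines: \<open>p\<close>,
  \<open>q\<close>, \<open>r\<close> are the lengths of \<open>ab\<close>, \<open>ac\<close>,
  \<open>ad\<close>, and \<open>u\<close>, \<open>v\<close>, \<open>w\<close> the scalar products of
  \<open>ab\<close> with \<open>ac\<close>, \<open>ab\<close> with \<open>ad\<close>,
  \<open>ac\<close> with \<open>ad\<close>.\<close>

lemma cos_diff_over_sines:
  fixes p q r s t u v w :: real
  assumes "p > 0" "q > 0" "r > 0"
  shows "(w / (q * r) - u / (p * q) * (v / (p * r)))
           / (sqrt (1 - (u / (p * q))\<^sup>2) * sqrt (1 - (v / (p * r))\<^sup>2))
       = (w * p\<^sup>2 - u * v) / (sqrt (p\<^sup>2 * q\<^sup>2 - u\<^sup>2) * sqrt (p\<^sup>2 * r\<^sup>2 - v\<^sup>2))"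
proof -
  have sine: "sqrt (1 - (u / (p * q))\<^sup>2) = sqrt (p\<^sup>2 * q\<^sup>2 - u\<^sup>2) / (p * q)" if "p > 0" "q > 0" for p q u :: real
  proof -
    have "1 - (u / (p * q))\<^sup>2 = (p\<^sup>2 * q\<^sup>2 - u\<^sup>2) / (p * q)\<^sup>2"
      using that by (simp add: field_simps power_mult_distrib)
    then show ?thesis using that by (simp add: real_sqrt_divide real_sqrt_abs)
  qed
  have "w / (q * r) - u / (p * q) * (v / (p * r)) = (w * p\<^sup>2 - u * v) / (p * q * (p * r))"
    using assms by (simp add: field_simps power2_eq_square)
  then show ?thesis unfolding sine[OF assms(1,2)] sine[OF assms(1,3)] using assms by simp
qed

section \<open>Dihedral angles in a triangulation\<close>

locale geometric_triangulation =
  fixes T :: "('v, 'e, 't) triang" and x :: "'v \<Rightarrow> real^3"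
  assumes tri: "oriented_3manifold_triangulation T"
    and gen: "general_position T x"
begin

lemmas tri_conjuncts = tri[unfolded oriented_3manifold_triangulation_def]

lemma finite_tets: "finite (tets T)"
  by (rule tri_conjuncts[THEN conjunct1])

lemma tv_inj: "t \<in> tets T \<Longrightarrow> inj_on (tv T t) {..<4}"
  by (rule tri_conjuncts[THEN conjunct2, THEN conjunct1, rule_format])

lemma te_ends:
  assumes "t \<in> tets T" "i < 4" "j < 4" "i \<noteq> j"
  shows "{eA T (te T t i j), eB T (te T t i j)} = {tv T t i, tv T t j}"
  by (rule tri_conjuncts[THEN conjunct2, THEN conjunct2, THEN conjunct1, rule_format,
        OF assms, THEN conjunct2])

lemma te_commute:
  assumes "t \<in> tets T" "i < 4" "j < 4"
  shows "te T t i j = te T t j i"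
  using tri_conjuncts[THEN conjunct2, THEN conjunct2, THEN conjunct1, rule_format,
      OF assms, THEN conjunct1]
  by (cases "i = j") simp_all

lemma te_in_tri_edges: "t \<in> tets T \<Longrightarrow> i < 4 \<Longrightarrow> j < 4 \<Longrightarrow> i \<noteq> j \<Longrightarrow> te T t i j \<in> tri_edges T"
  by (auto simp: tri_edges_def)

lemma tv_in_tri_verts: "t \<in> tets T \<Longrightarrow> i < 4 \<Longrightarrow> tv T t i \<in> tri_verts T"
  by (auto simp: tri_verts_def)

lemma finite_tri_edges: "finite (tri_edges T)"
proof (rule finite_subset)
  show "tri_edges T \<subseteq> (\<lambda>(t, i, j). te T t i j) ` (tets T \<times> {..<4} \<times> {..<4})"
    by (force simp: tri_edges_def)
qed (simp add: finite_tets)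

lemma glueD:
  assumes "t \<in> tets T" "k < 4" "glue T t k = Some (t', \<sigma>)"
  shows "t' \<in> tets T" "\<sigma> permutes {..<4}" "\<not> evenperm \<sigma>" "glue T t' (\<sigma> k) = Some (t, inv \<sigma>)"
    "i < 4 \<Longrightarrow> i \<noteq> k \<Longrightarrow> tv T t' (\<sigma> i) = tv T t i"
    "i < 4 \<Longrightarrow> j < 4 \<Longrightarrow> i \<noteq> j \<Longrightarrow> i \<noteq> k \<Longrightarrow> j \<noteq> k \<Longrightarrow> te T t' (\<sigma> i) (\<sigma> j) = te T t i j"
  using tri_conjuncts[THEN conjunct2, THEN conjunct2, THEN conjunct2, THEN conjunct1, rule_format,
      OF assms] by blast+

lemma on_edges_commute: "t \<in> tets T \<Longrightarrow> on_edges T t f i j = on_edges T t f j i"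
  by (auto simp: on_edges_def te_commute)

lemma signed_volume_tet:
  assumes "t \<in> tets T" "distinct [a, b, c, d]" "{a, b, c, d} \<subseteq> {..<4}"
  shows "signed_volume x (tv T t a) (tv T t b) (tv T t c) (tv T t d) \<noteq> 0"
proof -
  have d: "distinct [tv T t a, tv T t b, tv T t c, tv T t d]"
    using tv_inj[OF assms(1)] assms(2,3) by (auto simp: inj_on_def)
  have s: "{tv T t a, tv T t b, tv T t c, tv T t d} \<subseteq> tri_verts T"
    using assms by (auto intro: tv_in_tri_verts)
  have "card {tv T t a, tv T t b, tv T t c, tv T t d} \<le> 4"
    using d by simp
  note g = gen[unfolded general_position_def, rule_format, OF s this]
  show ?thesis by (rule signed_volume_nonzero[OF conjunct1[OF g] d conjunct2[OF g]])
qed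

lemma tet_volume_permute:
  assumes "t \<in> tets T" "p permutes {..<4}"
  shows "sgn (tet_volume T x t) = sign p *
     sgn (signed_volume x (tv T t (p 0)) (tv T t (p 1)) (tv T t (p 2)) (tv T t (p 3)))"
proof -
  have "tet_volume T x t = signed_volume x (tv T t 0) (tv T t 1) (tv T t 2) (tv T t 3) / 6"
    unfolding tet_volume_def signed_volume_def dot_cross_det[symmetric]
    by (subst cross_triple) (simp add: inner_commute)
  then have "sgn (tet_volume T x t) = sgn (signed_volume x (tv T t 0) (tv T t 1) (tv T t 2) (tv T t 3))"
    by (simp add: sgn_if)
  then show ?thesis
    unfolding signed_volume_permute[OF assms(2), of x "tv T t"]
    by (cases p rule: sign_cases) (simp_all add: sgn_mult sgn_minus)
qed

lemma edge_ends_distinct: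
  assumes "e \<in> tri_edges T"
  shows "x (eA T e) \<noteq> x (eB T e)"
proof -
  obtain t i j where t: "t \<in> tets T" "i < 4" "j < 4" "i \<noteq> j" "e = te T t i j"
    using assms by (auto simp: tri_edges_def)
  have ne: "tv T t i \<noteq> tv T t j" using tv_inj[OF t(1)] t by (auto simp: inj_on_def)
  have s: "{tv T t i, tv T t j} \<subseteq> tri_verts T" "card {tv T t i, tv T t j} \<le> 4"
    using t ne by (auto intro: tv_in_tri_verts)
  have "inj_on x {tv T t i, tv T t j}"
    by (rule gen[unfolded general_position_def, rule_format, OF s, THEN conjunct1])
  then have "x (tv T t i) \<noteq> x (tv T t j)" using ne by (simp add: inj_on_def)
  then show ?thesis using te_ends[OF t(1-4)] t(5) by (auto simp: doubleton_eq_iff)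
qed

lemma edge_length_pos: "e \<in> tri_edges T \<Longrightarrow> edge_length T x e > 0"
  using edge_ends_distinct by (simp add: edge_length_def)

lemma edge_length_te:
  assumes "t \<in> tets T" "i < 4" "j < 4" "i \<noteq> j"
  shows "edge_length T X (te T t i j) = dist (X (tv T t i)) (X (tv T t j))"
  using te_ends[OF assms] by (auto simp: edge_length_def doubleton_eq_iff dist_commute)

lemma on_edges_edge_length:
  assumes "t \<in> tets T" "i < 4" "j < 4" "i \<noteq> j"
  shows "on_edges T t (\<lambda>e. (edge_length T X e)\<^sup>2) i j = (dist (X (tv T t i)) (X (tv T t j)))\<^sup>2"
  using assms by (simp add: on_edges_def edge_length_te)

lemma wedge_edge_length:
  assumes "t \<in> tets T" "distinct [a, b, c, d]" "{a, b, c, d} \<subseteq> {..<4}"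
  shows "wedge (on_edges T t (\<lambda>e. (edge_length T X e)\<^sup>2)) a b c d
    = face_normal X (tv T t a) (tv T t b) (tv T t c) \<bullet> face_normal X (tv T t a) (tv T t b) (tv T t d)"
proof -
  have "wedge (on_edges T t (\<lambda>e. (edge_length T X e)\<^sup>2)) a b c d
      = wedge (\<lambda>i j. (dist ((X \<circ> tv T t) i) ((X \<circ> tv T t) j))\<^sup>2) a b c d"
    using assms by (intro wedge_cong) (auto simp: on_edges_edge_length)
  then show ?thesis unfolding wedge_dist by (simp add: face_normal_def)
qed

lemma heron_edge_length:
  assumes "t \<in> tets T" "distinct [a, b, c]" "{a, b, c} \<subseteq> {..<4}"
  shows "heron (on_edges T t (\<lambda>e. (edge_length T X e)\<^sup>2)) a b c
    = face_normal X (tv T t a) (tv T t b) (tv T t c) \<bullet> face_normal X (tv T t a) (tv T t b) (tv T t c)"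
proof -
  have "heron (on_edges T t (\<lambda>e. (edge_length T X e)\<^sup>2)) a b c
      = heron (\<lambda>i j. (dist ((X \<circ> tv T t) i) ((X \<circ> tv T t) j))\<^sup>2) a b c"
    using assms by (intro heron_cong) (auto simp: on_edges_edge_length)
  then show ?thesis unfolding heron_dist by (simp add: face_normal_def)
qed

text \<open>Strict Cauchy-Schwarz inequality: two face normals of a tetrahedron of nonzero volume
  are not parallel. The argument of the arccosine thus lies strictly between -1 and 1, where it is
  differentiable.\<close>

lemma heron_wedge_nondegenerate:
  assumes "t \<in> tets T" "distinct [a, b, c, d]" "{a, b, c, d} \<subseteq> {..<4}"
  defines "S \<equiv> on_edges T t (\<lambda>e. (edge_length T x e)\<^sup>2)"
  shows "heron S a b c > 0" "heron S a b d > 0" "(wedge S a b c d)\<^sup>2 < heron S a b c * heron S a b d"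
proof -
  have abc: "distinct [a, b, c]" "{a, b, c} \<subseteq> {..<4}" and abd: "distinct [a, b, d]" "{a, b, d} \<subseteq> {..<4}"
    using assms(2,3) by auto
  note * = sgn_arccos_ratio_rate(2-4)[OF signed_volume_tet[OF assms(1-3), unfolded signed_volume_def]]
  show "heron S a b c > 0" "heron S a b d > 0" "(wedge S a b c d)\<^sup>2 < heron S a b c * heron S a b d"
    unfolding S_def wedge_edge_length[OF assms(1-3)] heron_edge_length[OF assms(1) abc]
      heron_edge_length[OF assms(1) abd] face_normal_def
    by (fact *)+
qed

text \<open>Stated for all positive lengths, because lengths that vary independently need not come
  from coordinates.\<close>

lemma dihedral_angle_eq:
  assumes t: "t \<in> tets T" and abcd: "distinct [a, b, c, d]" "{a, b, c, d} \<subseteq> {..<4}"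
    and L: "\<And>e. e \<in> tri_edges T \<Longrightarrow> L e > 0"
  defines "S \<equiv> on_edges T t (\<lambda>e. (L e)\<^sup>2)"
  shows "dihedral_angle T t L a b
    = arccos (wedge S a b c d / (sqrt (heron S a b c) * sqrt (heron S a b d)))"
proof -
  define r where "r c d = (cos_face_angle T t L a c d - cos_face_angle T t L a b c * cos_face_angle T t L a b d)
      / (sqrt (1 - (cos_face_angle T t L a b c)\<^sup>2) * sqrt (1 - (cos_face_angle T t L a b d)\<^sup>2))" for c d
  have r: "r c d = wedge S a b c d / (sqrt (heron S a b c) * sqrt (heron S a b d))"
    if "distinct [a, b, c, d]" "{a, b, c, d} \<subseteq> {..<4}" for c d
  proof -
    have cos: "cos_face_angle T t L i j k = corner_dot S i j k / (L (te T t i j) * L (te T t i k))"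
      if "distinct [i, j, k]" "{i, j, k} \<subseteq> {..<4}" for i j k
      using that by (simp add: cos_face_angle_def corner_dot_def S_def on_edges_def)
    have pos: "L (te T t a b) > 0" "L (te T t a c) > 0" "L (te T t a d) > 0"
      using that t by (auto intro!: L te_in_tri_edges)
    have 1: "cos_face_angle T t L a c d = corner_dot S a c d / (L (te T t a c) * L (te T t a d))"
      "cos_face_angle T t L a b c = corner_dot S a b c / (L (te T t a b) * L (te T t a c))"
      "cos_face_angle T t L a b d = corner_dot S a b d / (L (te T t a b) * L (te T t a d))"
      using that by (auto intro!: cos)
    have 2: "S a b = (L (te T t a b))\<^sup>2" "S a c = (L (te T t a c))\<^sup>2" "S a d = (L (te T t a d))\<^sup>2"
      using that by (auto simp: S_def on_edges_def)
    show ?thesis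
      unfolding r_def 1 cos_diff_over_sines[OF pos] wedge_def heron_def 2 ..
  qed
  have "cos_face_angle T t L a d c = cos_face_angle T t L a c d"
    using te_commute[OF t, of d c] abcd(2) by (simp add: cos_face_angle_def ac_simps)
  then have "r d c = r c d" by (simp add: r_def mult.commute)
  moreover have "dihedral_angle T t L a b = arccos (r (Min {c, d}) (Max {c, d}))"
    unfolding dihedral_angle_def remaining_positions[OF abcd] r_def Let_def ..
  ultimately have "dihedral_angle T t L a b = arccos (r c d)"
    by (auto simp: min_def max_def)
  then show ?thesis using r[OF abcd] by simp
qed

lemma dihedral_rate_eq:
  assumes "t \<in> tets T" "distinct [a, b, c, d]" "{a, b, c, d} \<subseteq> {..<4}"
  shows "dihedral_rate T t L L' a b
    = angle_rate (on_edges T t (\<lambda>e. (L e)\<^sup>2)) (on_edges T t (\<lambda>e. 2 * L e * L' e)) a b c d"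
  unfolding dihedral_rate_def using assms by (intro edge_angle_rate_eq on_edges_commute) auto

lemma dihedral_rate_commute:
  assumes "t \<in> tets T"
  shows "dihedral_rate T t L L' a b = dihedral_rate T t L L' b a"
  unfolding dihedral_rate_def using assms by (intro edge_angle_rate_commute on_edges_commute)

text \<open>The closed form needs positive lengths, and by continuity these persist near the given
  configuration; a derivative depends on no more than that.\<close>

lemma dihedral_angle_eventually:
  fixes L :: "real \<Rightarrow> 'e \<Rightarrow> real"
  assumes t: "t \<in> tets T" and abcd: "distinct [a, b, c, d]" "{a, b, c, d} \<subseteq> {..<4}"
    and L: "\<And>e. e \<in> tri_edges T \<Longrightarrow> ((\<lambda>r. L r e) has_real_derivative L' e) (at r)"
    and Lr: "L r = edge_length T x"
  shows "\<forall>\<^sub>F s in nhds r. dihedral_angle T t (L s) a b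
    = arccos (wedge (on_edges T t (\<lambda>e. (L s e)\<^sup>2)) a b c d
        / (sqrt (heron (on_edges T t (\<lambda>e. (L s e)\<^sup>2)) a b c)
           * sqrt (heron (on_edges T t (\<lambda>e. (L s e)\<^sup>2)) a b d)))"
proof -
  have "\<forall>\<^sub>F s in nhds r. L s e > 0" if "e \<in> tri_edges T" for e
  proof -
    have "isCont (\<lambda>r. L r e) r" using L[OF that] by (rule DERIV_isCont)
    then have "((\<lambda>r. L r e) \<longlongrightarrow> L r e) (nhds r)" by (simp add: isCont_def tendsto_nhds_iff)
    then show ?thesis using edge_length_pos[OF that] Lr by (intro order_tendstoD(1)) auto
  qed
  then have "\<forall>\<^sub>F s in nhds r. \<forall>e\<in>tri_edges T. L s e > 0"
    using finite_tri_edges by (simp add: eventually_ball_finite)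
  then show ?thesis
    by eventually_elim (use dihedral_angle_eq[OF t abcd] in blast)
qed

text \<open>The curve \<open>L\<close> of lengths is arbitrary, so that the lemma covers both the
  variation of a single length and the lengths induced by moving vertices.\<close>

lemma dihedral_angle_has_derivative:
  fixes L :: "real \<Rightarrow> 'e \<Rightarrow> real"
  assumes t: "t \<in> tets T" and ab: "a < 4" "b < 4" "a \<noteq> b"
    and L: "\<And>e. e \<in> tri_edges T \<Longrightarrow> ((\<lambda>r. L r e) has_real_derivative L' e) (at r)"
    and Lr: "L r = edge_length T x"
  shows "((\<lambda>s. dihedral_angle T t (L s) a b) has_real_derivative
           dihedral_rate T t (edge_length T x) L' a b) (at r)"
proof -
  obtain c d where abcd: "distinct [a, b, c, d]" "{a, b, c, d} \<subseteq> {..<4}"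
    using remaining_positions_exist[OF ab(3,1,2)] by blast
  define S where "S s = on_edges T t (\<lambda>e. (L s e)\<^sup>2)" for s
  have S: "((\<lambda>r. S r i j) has_real_derivative on_edges T t (\<lambda>e. 2 * L r e * L' e) i j) (at r)" for i j
  proof (cases "i < 4 \<and> j < 4 \<and> i \<noteq> j")
    case True
    then have "((\<lambda>r. (L r (te T t i j))\<^sup>2) has_real_derivative 2 * L r (te T t i j) * L' (te T t i j)) (at r)"
      by (auto intro!: derivative_eq_intros L te_in_tri_edges t)
    then show ?thesis using True by (simp add: S_def on_edges_def)
  qed (auto simp: S_def on_edges_def)
  have Sr: "S r = on_edges T t (\<lambda>e. (edge_length T x e)\<^sup>2)" by (simp add: S_def Lr)
  note w = wedge_has_derivative[where S=S and a=a and b=b and c=c and d=d, OF S]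
  note h1 = heron_has_derivative[where S=S and a=a and b=b and c=c, OF S]
  note h2 = heron_has_derivative[where S=S and a=a and b=b and c=d, OF S]
  have "((\<lambda>s. arccos (wedge (S s) a b c d / (sqrt (heron (S s) a b c) * sqrt (heron (S s) a b d))))
      has_real_derivative dihedral_rate T t (edge_length T x) L' a b) (at r)"
    unfolding dihedral_rate_eq[OF t abcd] angle_rate_def
    using arccos_ratio_has_derivative[OF w h1 h2] heron_wedge_nondegenerate[OF t abcd]
    unfolding Sr Lr by simp
  moreover have "\<forall>\<^sub>F s in nhds r. dihedral_angle T t (L s) a b
      = arccos (wedge (S s) a b c d / (sqrt (heron (S s) a b c) * sqrt (heron (S s) a b d)))"
    unfolding S_def by (rule dihedral_angle_eventually[OF t abcd L Lr])
  ultimately show ?thesis by (subst DERIV_cong_ev[OF refl _ refl])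
qed

section \<open>Derivatives of the angle sums with respect to lengths, and their symmetry\<close>

lemma aroundD:
  assumes "(t, a, b) \<in> around T e"
  shows "t \<in> tets T" "a < 4" "b < 4" "a \<noteq> b"
  using assms by (auto simp: around_def)

text \<open>Summing over all tetrahedra and pairs makes the range independent of \<open>e\<close>,
  so that sums belonging to different edges can be exchanged.\<close>

lemma sum_around:
  fixes h :: "'t \<Rightarrow> nat \<Rightarrow> nat \<Rightarrow> real"
  shows "(\<Sum>(t, a, b)\<in>around T e. h t a b)
    = (\<Sum>t\<in>tets T. \<Sum>(a, b)\<in>pairs. if te T t a b = e then h t a b else 0)"
proof -
  have "around T e = {z \<in> tets T \<times> pairs. case z of (t, a, b) \<Rightarrow> te T t a b = e}"
    by (auto simp: around_def pairs_def)
  then have "(\<Sum>(t, a, b)\<in>around T e. h t a b)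
      = (\<Sum>(t, a, b)\<in>tets T \<times> pairs. if te T t a b = e then h t a b else 0)"
    using finite_tets finite_pairs
    by (simp add: sum.inter_filter case_prod_unfold)
  then show ?thesis
    by (simp add: sum.cartesian_product)
qed

lemma deficit_has_derivative:
  fixes L :: "real \<Rightarrow> 'e \<Rightarrow> real"
  assumes L: "\<And>e. e \<in> tri_edges T \<Longrightarrow> ((\<lambda>r. L r e) has_real_derivative L' e) (at r)"
    and Lr: "L r = edge_length T x"
  shows "((\<lambda>s. deficit T x i (L s)) has_real_derivative
    - (\<Sum>(t, a, b)\<in>around T i. sgn (tet_volume T x t) * dihedral_rate T t (edge_length T x) L' a b)) (at r)"
  unfolding deficit_def
proof (rule DERIV_minus, rule DERIV_sum)
  fix z assume "z \<in> around T i"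
  then obtain t a b where z: "z = (t, a, b)" "(t, a, b) \<in> around T i" by (cases z) auto
  show "((\<lambda>s. case z of (t, a, b) \<Rightarrow> sgn (tet_volume T x t) * dihedral_angle T t (L s) a b)
      has_real_derivative (case z of (t, a, b) \<Rightarrow> sgn (tet_volume T x t) *
         dihedral_rate T t (edge_length T x) L' a b)) (at r)"
    unfolding z(1) prod.case
    by (intro DERIV_cmult dihedral_angle_has_derivative[OF aroundD[OF z(2)] L Lr])
qed

lemma f3_entry_eq:
  "f3_entry T x i j = - (\<Sum>(t, a, b)\<in>around T i. sgn (tet_volume T x t) *
     dihedral_rate T t (edge_length T x) (\<lambda>e. if e = j then 1 else 0) a b)"
  unfolding f3_entry_def partial_at_def
proof (rule DERIV_imp_deriv, rule deficit_has_derivative)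
  fix e
  show "((\<lambda>s. ((edge_length T x)(j := s)) e) has_real_derivative (if e = j then 1 else 0))
      (at (edge_length T x j))"
    by (cases "e = j") (auto intro!: derivative_eq_intros)
qed simp

text \<open>The finite sum recovers \<open>g\<close> because \<open>on_edges\<close> reads it only
  at edges of the triangulation.\<close>

lemma dihedral_rate_sum_unit:
  assumes "t \<in> tets T"
  shows "(\<Sum>j\<in>tri_edges T. g j * dihedral_rate T t L (\<lambda>e. if e = j then 1 else 0) a b)
    = dihedral_rate T t L g a b"
proof -
  have "on_edges T t (\<lambda>e. 2 * L e * g e)
      = (\<lambda>i k. \<Sum>j\<in>tri_edges T. g j * on_edges T t (\<lambda>e. 2 * L e * (if e = j then 1 else 0)) i k)"
  proof (intro ext)
    fix i k
    show "on_edges T t (\<lambda>e. 2 * L e * g e) i k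
      = (\<Sum>j\<in>tri_edges T. g j * on_edges T t (\<lambda>e. 2 * L e * (if e = j then 1 else 0)) i k)"
    proof (cases "i < 4 \<and> k < 4 \<and> i \<noteq> k")
      case True
      have "(\<Sum>j\<in>tri_edges T. g j * (2 * L (te T t i k) * (if te T t i k = j then 1 else 0)))
        = (\<Sum>j\<in>tri_edges T. if te T t i k = j then g j * (2 * L (te T t i k)) else 0)"
        by (intro sum.cong) auto
      then show ?thesis
        using True finite_tri_edges te_in_tri_edges[OF assms, of i k]
        by (simp add: on_edges_def sum.delta')
    qed (auto simp: on_edges_def)
  qed
  then show ?thesis
    by (simp only: dihedral_rate_def edge_angle_rate_sum)
qed

text \<open>Chain rule: a row of the matrix applied to \<open>g\<close> is the derivative of the
  angle sum when all lengths change with velocity \<open>g\<close>.\<close>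

lemma sum_f3_entry:
  "(\<Sum>j\<in>tri_edges T. f3_entry T x i j * g j)
    = - (\<Sum>(t, a, b)\<in>around T i. sgn (tet_volume T x t) * dihedral_rate T t (edge_length T x) g a b)"
proof -
  let ?u = "\<lambda>j e. if e = j then 1 else (0::real)"
  have "(\<Sum>j\<in>tri_edges T. f3_entry T x i j * g j)
      = - (\<Sum>j\<in>tri_edges T. \<Sum>(t, a, b)\<in>around T i. sgn (tet_volume T x t) *
            (g j * dihedral_rate T t (edge_length T x) (?u j) a b))"
    unfolding f3_entry_eq
    by (simp add: sum_distrib_left sum_negf case_prod_unfold ac_simps)
  also have "\<dots> = - (\<Sum>(t, a, b)\<in>around T i. sgn (tet_volume T x t) *
      (\<Sum>j\<in>tri_edges T. g j * dihedral_rate T t (edge_length T x) (?u j) a b))"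
    by (subst sum.swap) (simp add: sum_distrib_left case_prod_unfold)
  also have "\<dots> = - (\<Sum>(t, a, b)\<in>around T i. sgn (tet_volume T x t) * dihedral_rate T t (edge_length T x) g a b)"
    by (intro arg_cong[of _ _ uminus] sum.cong refl)
      (auto simp: dihedral_rate_sum_unit around_def)
  finally show ?thesis .
qed

text \<open>Passes from edges of the triangulation to positions in \<open>t\<close>, where
  \<open>edge_angle_rate_symmetric\<close> applies. The sum avoids deciding where, if at all,
  \<open>j\<close> occurs in \<open>t\<close>.\<close>

lemma dihedral_rate_unit:
  assumes "t \<in> tets T"
  shows "dihedral_rate T t L (\<lambda>e. if e = j then 1 else 0) a b
    = (\<Sum>(c, d)\<in>pairs. if te T t c d = j
         then 2 * L (te T t c d) * edge_angle_rate (on_edges T t (\<lambda>e. (L e)\<^sup>2)) (pair_indicator c d) a b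
         else 0)"
proof -
  define g where "g = (\<lambda>(c, d). if te T t c d = j then 2 * L (te T t c d) else 0)"
  have "on_edges T t (\<lambda>e. 2 * L e * (if e = j then 1 else 0))
      = (\<lambda>i k. \<Sum>z\<in>pairs. g z * pair_indicator (fst z) (snd z) i k)"
  proof (intro ext)
    fix i k
    show "on_edges T t (\<lambda>e. 2 * L e * (if e = j then 1 else 0)) i k
      = (\<Sum>z\<in>pairs. g z * pair_indicator (fst z) (snd z) i k)"
    proof (cases "i < 4 \<and> k < 4 \<and> i \<noteq> k")
      case True
      \<comment> \<open>Exactly one increasing pair has the underlying set \<open>{i, k}\<close>, so
        the sum collapses to one term.\<close>
      have "(\<Sum>z\<in>pairs. g z * pair_indicator (fst z) (snd z) i k)
          = (\<Sum>z\<in>pairs. if z = (min i k, max i k) then g z else 0)"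
      proof (rule sum.cong[OF refl])
        fix z assume "z \<in> pairs"
        then obtain c d where z: "z = (c, d)" "c < d" by (auto simp: pairs_def)
        have "{i, k} = {c, d} \<longleftrightarrow> (c, d) = (min i k, max i k)"
        proof (cases "i < k")
          case True
          then show ?thesis using z(2) by (auto simp: doubleton_eq_iff)
        next
          case False
          then show ?thesis using z(2) True by (auto simp: doubleton_eq_iff)
        qed
        then show "g z * pair_indicator (fst z) (snd z) i k = (if z = (min i k, max i k) then g z else 0)"
          by (simp add: z(1) pair_indicator_def)
      qed
      moreover have "(min i k, max i k) \<in> pairs" using True by (auto simp: pairs_def min_def max_def)
      moreover have "te T t (min i k) (max i k) = te T t i k"
        using te_commute[OF assms, of i k] True by (simp add: min_def max_def)
      ultimately show ?thesis
        using True finite_pairs by (simp add: on_edges_def sum.delta g_def)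
    next
      case False
      then have "pair_indicator (fst z) (snd z) i k = 0" if "z \<in> pairs" for z
        using that by (auto simp: pairs_def pair_indicator_def doubleton_eq_iff)
      then show ?thesis using False by (auto simp: on_edges_def)
    qed
  qed
  then have "dihedral_rate T t L (\<lambda>e. if e = j then 1 else 0) a b
    = (\<Sum>z\<in>pairs. g z * edge_angle_rate (on_edges T t (\<lambda>e. (L e)\<^sup>2)) (pair_indicator (fst z) (snd z)) a b)"
    by (simp only: dihedral_rate_def edge_angle_rate_sum)
  also have "\<dots> = (\<Sum>(c, d)\<in>pairs. if te T t c d = j
         then 2 * L (te T t c d) * edge_angle_rate (on_edges T t (\<lambda>e. (L e)\<^sup>2)) (pair_indicator c d) a b
         else 0)"
    by (intro sum.cong) (auto simp: g_def)
  finally show ?thesis .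
qed

text \<open>Each entry is a sum over tetrahedra, and within one over an occurrence of
  \<open>i\<close> and an occurrence of \<open>j\<close>. The sign of the volume belongs to the
  tetrahedron and not to an edge, so it does not disturb the exchange of the two
  occurrences.\<close>

lemma f3_entry_sym: "f3_entry T x i j = f3_entry T x j i"
proof -
  define L where "L = edge_length T x"
  \<comment> \<open>\<open>H t (a, b) (c, d)\<close> is the derivative of the angle of
    \<open>t\<close> at \<open>ab\<close> by the length of \<open>cd\<close>, taken as a variable of
    \<open>t\<close> alone.\<close>
  define H where "H t = (\<lambda>(a, b) (c, d). 2 * L (te T t c d) *
      edge_angle_rate (on_edges T t (\<lambda>e. (L e)\<^sup>2)) (pair_indicator c d) a b)" for t
  define Q where "Q t e z = (case z of (a, b) \<Rightarrow> te T t a b = e)" for t e and z :: "nat \<times> nat"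
  have H: "H t y z = H t z y" if t: "t \<in> tets T" and "y \<in> pairs" "z \<in> pairs" for t y z
  proof -
    obtain a b c d where yz: "y = (a, b)" "z = (c, d)" by (cases y, cases z)
    have ab: "a < b" "b < 4" and cd: "c < d" "d < 4" using that yz by (auto simp: pairs_def)
    have pos: "L (te T t i j) > 0" if "i < 4" "j < 4" "i \<noteq> j" for i j
      using that t by (auto simp: L_def intro!: edge_length_pos te_in_tri_edges)
    define S where "S = on_edges T t (\<lambda>e. (L e)\<^sup>2)"
    have sqrt: "sqrt (S i j) = L (te T t i j)" if "i < 4" "j < 4" "i \<noteq> j" for i j
      using that pos[OF that] by (simp add: S_def on_edges_def)
    have "sqrt (S c d) * edge_angle_rate S (pair_indicator c d) a b
       = sqrt (S a b) * edge_angle_rate S (pair_indicator a b) c d"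
    proof (rule edge_angle_rate_symmetric[OF _ _ _ ab cd])
      show "S i j = S j i" for i j unfolding S_def by (rule on_edges_commute[OF t])
      show "S i j > 0" if "i < 4" "j < 4" "i \<noteq> j" for i j
        using that pos[OF that] by (simp add: S_def on_edges_def)
      show "heron S i j k \<noteq> 0" if ijk: "distinct [i, j, k]" "{i, j, k} \<subseteq> {..<4}" for i j k
      proof -
        obtain l where "distinct [i, j, k, l]" "{i, j, k, l} \<subseteq> {..<4}"
          using fourth_position_exists[OF ijk] by blast
        from heron_wedge_nondegenerate(1)[OF t this] show ?thesis by (simp add: S_def L_def)
      qed
    qed
    then show ?thesis
      using ab cd by (simp add: H_def yz sqrt S_def[symmetric])
  qed
  have f3: "f3_entry T x i j = - (\<Sum>t\<in>tets T. sgn (tet_volume T x t) *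
      (\<Sum>y\<in>pairs. \<Sum>z\<in>pairs. if Q t i y \<and> Q t j z then H t y z else 0))" for i j
  proof -
    have "sgn (tet_volume T x t) * (\<Sum>y\<in>pairs. \<Sum>z\<in>pairs. if Q t i y \<and> Q t j z then H t y z else 0)
      = (\<Sum>(a, b)\<in>pairs. if te T t a b = i
          then sgn (tet_volume T x t) * dihedral_rate T t L (\<lambda>e. if e = j then 1 else 0) a b else 0)"
      if "t \<in> tets T" for t
      unfolding sum_distrib_left
    proof (rule sum.cong[OF refl], clarify)
      fix a b
      show "(\<Sum>z\<in>pairs. sgn (tet_volume T x t) * (if Q t i (a, b) \<and> Q t j z then H t (a, b) z else 0))
        = (if te T t a b = i
          then sgn (tet_volume T x t) * dihedral_rate T t L (\<lambda>e. if e = j then 1 else 0) a b else 0)"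
        unfolding dihedral_rate_unit[OF that]
        by (auto simp: Q_def H_def sum_distrib_left intro!: sum.cong)
    qed
    then show ?thesis
      unfolding f3_entry_eq sum_around L_def[symmetric] by simp
  qed
  have "(\<Sum>y\<in>pairs. \<Sum>z\<in>pairs. if Q t i y \<and> Q t j z then H t y z else 0)
      = (\<Sum>y\<in>pairs. \<Sum>z\<in>pairs. if Q t j y \<and> Q t i z then H t y z else 0)" if "t \<in> tets T" for t
    by (subst sum.swap) (intro sum.cong refl, use H[OF that] in auto)
  then show ?thesis unfolding f3 by simp
qed

subsection \<open>Constancy of the angle sums\<close>

text \<open>The angle is differentiated along the motion in two ways, through the edge lengths and
  through the face normals. The factor \<open>sign p\<close> compares the vertex order
  \<open>p\<close> with the positive one.\<close>

lemma signed_dihedral_rate: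
  fixes X :: "real \<Rightarrow> 'v \<Rightarrow> real^3"
  assumes t: "t \<in> tets T" and p: "p permutes {..<4}"
    and X: "\<And>v. ((\<lambda>r. X r v) has_vector_derivative X' v) (at r)" and Xr: "X r = x"
    and L': "\<And>e. e \<in> tri_edges T \<Longrightarrow> ((\<lambda>r. edge_length T (X r) e) has_real_derivative L' e) (at r)"
  shows "sgn (tet_volume T x t) * dihedral_rate T t (edge_length T x) L' (p 0) (p 1)
    = sign p * (face_rate x X' (tv T t (p 0)) (tv T t (p 1)) (tv T t (p 3))
              - face_rate x X' (tv T t (p 0)) (tv T t (p 1)) (tv T t (p 2)))"
proof -
  note P = permutes_lessThan_4[OF p]
  have P1: "distinct [p 0, p 1, p 2]" "{p 0, p 1, p 2} \<subseteq> {..<4}"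
    and P2: "distinct [p 0, p 1, p 3]" "{p 0, p 1, p 3} \<subseteq> {..<4}" using P by auto
  have p01: "p 0 < 4" "p 1 < 4" "p 0 \<noteq> p 1" using P by auto
  let ?v = "\<lambda>i. tv T t (p i)"
  let ?s = "sgn (signed_volume (X r) (?v 0) (?v 1) (?v 2) (?v 3))"
  have vol: "signed_volume (X r) (?v 0) (?v 1) (?v 2) (?v 3) \<noteq> 0"
    unfolding Xr by (rule signed_volume_tet[OF t P])
  have "((\<lambda>s. ?s * dihedral_angle T t (edge_length T (X s)) (p 0) (p 1)) has_real_derivative
      face_rate (X r) X' (?v 0) (?v 1) (?v 3) - face_rate (X r) X' (?v 0) (?v 1) (?v 2)) (at r)"
  proof (subst DERIV_cong_ev[OF refl _ refl])
    show "\<forall>\<^sub>F s in nhds r. ?s * dihedral_angle T t (edge_length T (X s)) (p 0) (p 1)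
      = ?s * arccos (face_normal (X s) (?v 0) (?v 1) (?v 2) \<bullet> face_normal (X s) (?v 0) (?v 1) (?v 3)
               / (sqrt (face_normal (X s) (?v 0) (?v 1) (?v 2) \<bullet> face_normal (X s) (?v 0) (?v 1) (?v 2))
                  * sqrt (face_normal (X s) (?v 0) (?v 1) (?v 3) \<bullet> face_normal (X s) (?v 0) (?v 1) (?v 3))))"
      using dihedral_angle_eventually[OF t P, of "\<lambda>s. edge_length T (X s)", OF L'
          arg_cong[of _ _ "edge_length T", OF Xr]]
      unfolding wedge_edge_length[OF t P] heron_edge_length[OF t P1] heron_edge_length[OF t P2]
      by (rule eventually_mono) (simp_all only:)
  qed (rule signed_angle_has_derivative[OF X vol])
  moreover have "((\<lambda>s. ?s * dihedral_angle T t (edge_length T (X s)) (p 0) (p 1)) has_real_derivative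
      ?s * dihedral_rate T t (edge_length T x) L' (p 0) (p 1)) (at r)"
    using Xr by (intro DERIV_cmult dihedral_angle_has_derivative[OF t p01 L']) simp_all
  ultimately have "?s * dihedral_rate T t (edge_length T x) L' (p 0) (p 1)
    = face_rate x X' (?v 0) (?v 1) (?v 3) - face_rate x X' (?v 0) (?v 1) (?v 2)"
    using DERIV_unique unfolding Xr by blast
  then show ?thesis
    unfolding tet_volume_permute[OF t p] Xr by (simp add: mult.assoc)
qed

text \<open>Gluing two tetrahedra along a face composes vertex orders with an odd permutation, so the two
  contributions of an interior face cancel; faces in the boundary do not move.\<close>
lemma sum_face_rate_eq_0:
  assumes X': "\<And>v. v \<in> bdry_verts T \<Longrightarrow> X' v = 0"
  shows "(\<Sum>t\<in>tets T. \<Sum>p | p permutes {..<4}. if te T t (p 0) (p 1) = e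
    then sign p * face_rate x X' (tv T t (p 0)) (tv T t (p 1)) (tv T t (p 2)) else 0) = 0"
proof -
  define P where "P = {p. p permutes {..<4::nat}}"
  define F where "F = (\<lambda>(t, p). if te T t (p 0) (p 1) = e
    then sign p * face_rate x X' (tv T t (p 0)) (tv T t (p 1)) (tv T t (p 2)) else 0)"
  \<comment> \<open>The face spanned by \<open>p 0\<close>, \<open>p 1\<close>, \<open>p 2\<close>
    is the one opposite \<open>p 3\<close>. \<open>A\<close> collects the orders for which it is
    interior, and \<phi> carries such an order into the tetrahedron on the other side.\<close>
  define A where "A = {(t, p). t \<in> tets T \<and> p \<in> P \<and> glue T t (p 3) \<noteq> None}"
  define \<phi> where "\<phi> = (\<lambda>(t, p :: nat \<Rightarrow> nat). case the (glue T t (p 3)) of (t', \<sigma>) \<Rightarrow> (t', \<sigma> \<circ> p))"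
  have boundary: "F (t, p) = 0" if "t \<in> tets T" "p \<in> P" "glue T t (p 3) = None" for t p
  proof -
    note p = permutes_lessThan_4[of p]
    have "bface T t (p 3)" using that p by (simp add: bface_def P_def)
    then have "tv T t (p i) \<in> bdry_verts T" if "i \<in> {0, 1, 2}" for i
      using that p \<open>p \<in> P\<close> unfolding bdry_verts_def P_def by fastforce
    then have "X' (tv T t (p i)) = 0" if "i \<in> {0, 1, 2}" for i using that X' by blast
    then show ?thesis by (simp add: F_def face_rate_def face_normal_rate_def)
  qed
  have A: "\<phi> z \<in> A \<and> \<phi> (\<phi> z) = z \<and> F (\<phi> z) = - F z" if "z \<in> A" for z
  proof -
    obtain t p where z: "z = (t, p)" by (cases z)
    with that have t: "t \<in> tets T" and p: "p permutes {..<4}" and "glue T t (p 3) \<noteq> None"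
      by (auto simp: A_def P_def)
    then obtain t' \<sigma> where g: "glue T t (p 3) = Some (t', \<sigma>)" by auto
    note p4 = permutes_lessThan_4[OF p]
    have p3: "p 3 < 4" using p4 by simp
    note G = glueD[OF t p3 g]
    have \<phi>: "\<phi> z = (t', \<sigma> \<circ> p)" by (simp add: \<phi>_def z g)
    have sp: "\<sigma> \<circ> p permutes {..<4}" using p G(2) by (rule permutes_compose)
    have s: "sign (\<sigma> \<circ> p) = - sign p"
      using sign_compose[of \<sigma> p] G(2,3) p permutes_imp_permutation[of "{..<4::nat}"]
      by (simp add: sign_def)
    \<comment> \<open>The position opposite the same face seen from \<open>t'\<close> is
      \<open>\<sigma> (p 3)\<close>, and the gluing stored there is
      \<open>inv \<sigma>\<close>.\<close>
    have "\<phi> (\<phi> z) = z"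
      unfolding \<phi> using G(4) permutes_inv_o(2)[OF G(2)] by (simp add: \<phi>_def z o_assoc)
    moreover have "\<phi> z \<in> A" unfolding \<phi> using G(1,4) sp by (simp add: A_def P_def)
    moreover have "F (\<phi> z) = - F z"
    proof -
      have "tv T t' (\<sigma> (p 0)) = tv T t (p 0)" "tv T t' (\<sigma> (p 1)) = tv T t (p 1)"
        "tv T t' (\<sigma> (p 2)) = tv T t (p 2)" "te T t' (\<sigma> (p 0)) (\<sigma> (p 1)) = te T t (p 0) (p 1)"
        using p4 by (auto intro!: G(5,6))
      then show ?thesis unfolding \<phi> by (simp add: F_def z s)
    qed
    ultimately show ?thesis by blast
  qed
  have fin: "finite (tets T \<times> P)"
    unfolding P_def by (intro finite_cartesian_product finite_tets finite_permutations) simp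
  have "(\<Sum>t\<in>tets T. \<Sum>p\<in>P. F (t, p)) = sum F (tets T \<times> P)"
    by (simp add: sum.cartesian_product)
  also have "\<dots> = sum F A"
  proof (rule sum.mono_neutral_right[OF fin])
    show "\<forall>z\<in>tets T \<times> P - A. F z = 0" using boundary by (force simp: A_def)
  qed (auto simp: A_def)
  also have "\<dots> = 0"
    using A by (intro sum_eq_0_if_odd_involution[of A \<phi>]) blast+
  finally show ?thesis by (simp add: F_def P_def)
qed

text \<open>Multiplied by \<open>K\<close>, the sum runs over vertex orders, where each angle
  contributes its two faces separately. What remains is a multiple of the sum in
  \<open>sum_face_rate_eq_0\<close>.\<close>

lemma sum_signed_dihedral_rate_eq_0:
  fixes X :: "real \<Rightarrow> 'v \<Rightarrow> real^3"
  assumes X: "\<And>v. ((\<lambda>r. X r v) has_vector_derivative X' v) (at r)" and Xr: "X r = x"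
    and X': "\<And>v. v \<in> bdry_verts T \<Longrightarrow> X' v = 0"
    and L': "\<And>e. e \<in> tri_edges T \<Longrightarrow> ((\<lambda>r. edge_length T (X r) e) has_real_derivative L' e) (at r)"
  shows "(\<Sum>(t, a, b)\<in>around T e. sgn (tet_volume T x t) * dihedral_rate T t (edge_length T x) L' a b) = 0"
proof -
  define K where "K = card {p. p permutes {..<4::nat} \<and> {p 0, p 1} = {0, 1}}"
  define R where "R t a b = (if te T t a b = e
    then sgn (tet_volume T x t) * dihedral_rate T t (edge_length T x) L' a b else 0)" for t a b
  define F where "F t i p = (if te T t (p 0) (p 1) = e
    then sign p * face_rate x X' (tv T t (p 0)) (tv T t (p 1)) (tv T t (p i)) else 0)"
    for t i and p :: "nat \<Rightarrow> nat"
  have "K * (\<Sum>(a, b)\<in>pairs. R t a b) = - 2 * (\<Sum>p | p permutes {..<4}. F t 2 p)"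
    if t: "t \<in> tets T" for t
  proof -
    have "K * (\<Sum>(a, b)\<in>pairs. R t a b) = (\<Sum>p | p permutes {..<4}. R t (p 0) (p 1))"
      unfolding K_def using te_commute[OF t] dihedral_rate_commute[OF t]
      by (intro sum_permutations_pairs[symmetric]) (simp add: R_def)
    also have "\<dots> = (\<Sum>p | p permutes {..<4}. F t 3 p - F t 2 p)"
      using signed_dihedral_rate[OF t _ X Xr L']
      by (intro sum.cong refl) (auto simp: R_def F_def right_diff_distrib)
    also have "\<dots> = (\<Sum>p | p permutes {..<4}. F t 3 p) - (\<Sum>p | p permutes {..<4}. F t 2 p)"
      by (rule sum_subtractf)
    \<comment> \<open>Swapping the positions 2 and 3 keeps the edge, exchanges its two faces and
      reverses the sign, so both faces give the same total; hence the factor -2.\<close>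
    also have "(\<Sum>p | p permutes {..<4}. F t 3 p) = (\<Sum>p | p permutes {..<4}. - F t 2 p)"
    proof -
      let ?\<tau> = "Transposition.transpose 2 (3::nat)"
      have \<tau>: "?\<tau> permutes {..<4}" by (rule permutes_swap_id) auto
      have "F t 3 (p \<circ> ?\<tau>) = - F t 2 p" if "p permutes {..<4}" for p
      proof -
        have "sign (p \<circ> ?\<tau>) = - sign p"
          using sign_compose[of p ?\<tau>] that permutes_imp_permutation[of "{..<4::nat}"]
          by (simp add: sign_swap_id permutation_swap_id)
        then show ?thesis by (simp add: F_def)
      qed
      then show ?thesis
        by (subst sum_permutations_compose_right[OF \<tau>]) simp
    qed
    finally show ?thesis by (simp add: sum_negf)
  qed
  then have "K * (\<Sum>t\<in>tets T. \<Sum>(a, b)\<in>pairs. R t a b) = - 2 * (\<Sum>t\<in>tets T. \<Sum>p | p permutes {..<4}. F t 2 p)"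
    by (simp add: sum_distrib_left)
  also have "(\<Sum>t\<in>tets T. \<Sum>p | p permutes {..<4}. F t 2 p) = 0"
    unfolding F_def by (rule sum_face_rate_eq_0[OF X'])
  finally show ?thesis
    using card_pair_stabilizer_pos unfolding K_def by (simp add: sum_around R_def)
qed

section \<open>Motion of a single vertex along a coordinate axis\<close>

definition move :: "'v \<Rightarrow> 3 \<Rightarrow> real \<Rightarrow> 'v \<Rightarrow> real^3" where
  "move v k s w = (if w = v then x v + (s - x v $ k) *\<^sub>R axis k 1 else x w)"

lemma point_of_coords_of: "point_of ((coords_of x)((v, k) := s)) = move v k s"
  by (auto simp: fun_eq_iff point_of_def coords_of_def move_def vec_eq_iff axis_def)

lemma move_has_derivative:
  "((\<lambda>s. move v k s w) has_vector_derivative (if w = v then axis k 1 else 0)) (at r)"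
  unfolding move_def by (auto intro!: derivative_eq_intros)

text \<open>The parameter of \<open>move\<close> is the coordinate itself, as in
  \<open>partial_at\<close>; the given configuration therefore sits at \<open>x v $ k\<close> and
  not at 0.\<close>

lemma move_at: "move v k (x v $ k) = x"
  by (auto simp: move_def fun_eq_iff)

lemma f2_entry_deriv: "f2_entry T x j (v, k) = deriv (\<lambda>s. edge_length T (move v k s) j) (x v $ k)"
  unfolding f2_entry_def partial_at_def point_of_coords_of by (simp add: coords_of_def)

text \<open>\<open>f2_entry\<close> is defined by \<open>deriv\<close>, which carries information
  only where a derivative exists. It exists here because the ends of an edge have different
  coordinates, away from the singularity of the norm.\<close>

lemma edge_length_has_derivative:
  assumes "j \<in> tri_edges T"
  shows "((\<lambda>s. edge_length T (move v k s) j) has_real_derivative f2_entry T x j (v, k)) (at (x v $ k))"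
proof -
  let ?r = "x v $ k"
  let ?u = "\<lambda>s. move v k s (eA T j) - move v k s (eB T j)"
  have "\<exists>u'. (?u has_vector_derivative u') (at ?r)"
    using has_vector_derivative_diff[OF move_has_derivative move_has_derivative] by blast
  then obtain u' where u': "(?u has_vector_derivative u') (at ?r)" by blast
  have "?u ?r \<noteq> 0" using edge_ends_distinct[OF assms] by (simp add: move_at)
  then have "0 < ?u ?r \<bullet> ?u ?r" by simp
  from DERIV_chain2[OF DERIV_real_sqrt[OF this] inner_has_real_derivative[OF u' u']]
  have "\<exists>D. ((\<lambda>s. edge_length T (move v k s) j) has_real_derivative D) (at ?r)"
    by (auto simp: edge_length_def dist_norm norm_eq_sqrt_inner)
  then show ?thesis unfolding f2_entry_deriv using DERIV_imp_deriv by metis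
qed

lemma bdry_edges_subset: "bdry_edges T \<subseteq> tri_edges T"
  by (auto simp: bdry_edges_def tri_edges_def bface_def)

text \<open>Both ends of a boundary edge are boundary vertices, so its length is constant along the
  motion of an inner vertex.\<close>

lemma f2_entry_bdry:
  assumes "j \<in> bdry_edges T" "v \<in> inner_verts T"
  shows "f2_entry T x j (v, k) = 0"
proof -
  obtain t l a b where t: "bface T t l" "a < 4" "b < 4" "a \<noteq> b" "a \<noteq> l" "b \<noteq> l" "j = te T t a b"
    using assms(1) by (auto simp: bdry_edges_def)
  then have "tv T t a \<in> bdry_verts T" "tv T t b \<in> bdry_verts T" by (auto simp: bdry_verts_def)
  then have "eA T j \<in> bdry_verts T" "eB T j \<in> bdry_verts T"
    using te_ends[of t a b] t by (auto simp: bface_def doubleton_eq_iff)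
  then have "eA T j \<noteq> v" "eB T j \<noteq> v" using assms(2) by (auto simp: inner_verts_def)
  then show ?thesis by (simp add: f2_entry_deriv edge_length_def move_def)
qed

text \<open>The edges missing from the sum are boundary edges, and their terms vanish by
  \<open>f2_entry_bdry\<close>. The row \<open>i\<close> is arbitrary, which lets the lemma serve
  inner edges, \<open>D\<close> and, after transposition, \<open>C\<close>.\<close>

lemma f3_f2_eq_0:
  assumes v: "v \<in> inner_verts T" and C: "C \<subseteq> bdry_edges T"
  shows "(\<Sum>j\<in>inner_edges T \<union> C. f3_entry T x i j * f2_entry T x j (v, k)) = 0"
proof -
  have "(\<Sum>j\<in>inner_edges T \<union> C. f3_entry T x i j * f2_entry T x j (v, k))
      = (\<Sum>j\<in>tri_edges T. f3_entry T x i j * f2_entry T x j (v, k))"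
    using bdry_edges_subset C f2_entry_bdry[OF _ v]
    by (intro sum.mono_neutral_left finite_tri_edges) (auto simp: inner_edges_def)
  also have "\<dots> = 0"
    unfolding sum_f3_entry neg_equal_0_iff_equal
    by (rule sum_signed_dihedral_rate_eq_0[OF move_has_derivative move_at _ edge_length_has_derivative])
      (use v in \<open>auto simp: inner_verts_def\<close>)
  finally show ?thesis .
qed

end

theorem theorem3:
  fixes T :: "('v, 'e, 't) triang" and x :: "'v \<Rightarrow> real^3" and C D :: "'e set"
  assumes "oriented_3manifold_triangulation T"
    and "general_position T x"
    and "C \<subseteq> bdry_edges T" and "D \<subseteq> bdry_edges T"
    and "card C = card D"
  shows "(\<forall>i \<in> inner_edges T \<union> D. \<forall>v \<in> inner_verts T. \<forall>k::3.
            (\<Sum>j \<in> inner_edges T \<union> C. f3_entry T x i j * f2_entry T x j (v, k)) = 0)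
       \<and> (\<forall>v \<in> inner_verts T. \<forall>k::3. \<forall>j \<in> inner_edges T \<union> C.
            (\<Sum>i \<in> inner_edges T \<union> D. f4_entry T x (v, k) i * f3_entry T x i j) = 0)"
proof -
  interpret geometric_triangulation T x by unfold_locales (fact assms(1,2))+
  have "(\<Sum>i \<in> inner_edges T \<union> D. f4_entry T x (v, k) i * f3_entry T x i j) = 0"
    if "v \<in> inner_verts T" for v k j
  proof -
    \<comment> \<open>By symmetry this is row \<open>j\<close> of the first composition with
      \<open>D\<close> in the role of \<open>C\<close>.\<close>
    have "(\<Sum>i \<in> inner_edges T \<union> D. f4_entry T x (v, k) i * f3_entry T x i j)
        = - (\<Sum>i \<in> inner_edges T \<union> D. f3_entry T x j i * f2_entry T x i (v, k))"
      by (simp add: f4_entry_def sum_negf f3_entry_sym[of j] mult.commute)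
    then show ?thesis using f3_f2_eq_0[OF that assms(4)] by simp
  qed
  then show ?thesis using f3_f2_eq_0[OF _ assms(3)] by blast
qed

end
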